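(* Let $X$ be a bounded convex subset of a locally convex space $E$. Then $X$ is barycentric if and only if $X$ is compactly convex.
   Context: Locally convex spaces are real and Hausdorff. For a Tychonoff space $X$, $\hat P(X)$ is the set of all Radon probability measures on $X$ (Borel probability measures $\mu$ with $\mu(B)=\sup\{\mu(K):K\subset B \text{ compact}\}$ for all Borel $B\subset X$), with the weakest topology making all maps $\mu\mapsto\int_X f\,d\mu$, $f:X\to\mathbb R$ bounded continuous, continuous. For a locally convex space $E$, $E^*$ is the space of continuous linear functionals on $E$, with the topology of uniform convergence on weakly bounded subsets of $E$ (sets on which every $f\in E^*$ is bounded), and $E^{**}$ is the space of continuous linear functionals on $E^*$, with the topology of uniform convergence on equicontinuous subsets of $E^*$. The canonical map $E\to E^{**}$ is an embedding and $E$ is identified with its image. For bounded $X\subset E$ the barycenter map $b_X:\hat P(X)\to E^{**}$ is $b_X(\mu)(f)=\int_X f\,d\mu$, $f\in E^*$. A convex set $X\subset E$ is barycentric if $X$ is bounded in $E$ and $b_X(\hat P(X))\subset X$. A convex set $X\subset E$ is compactly convex if for each compact $K\subset X$ the closure in $X$ of the convex hull of $K$, $\mathrm{cl}_X(\mathrm{conv}(K))$, is compact. *)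

theory Defs
  imports "HOL-Probability.Probability"
begin

text \<open>Real Hausdorff locally convex spaces.  Joint continuity of scalar multiplication is stated
  through filters, in the style of \<^class>\<open>topological_monoid_add\<close>; convexity is unfolded because \<^const>\<open>convex\<close> is not available
  inside a class specification.\<close>

class locally_convex_space = real_vector + topological_ab_group_add + t2_space +
  assumes tendsto_scaleR_nhds:
    "((\<lambda>p. fst p *\<^sub>R snd p) \<longlongrightarrow> c *\<^sub>R x) (nhds c \<times>\<^sub>F nhds x)"
  and convex_nhds_0_raw:
    "open U \<Longrightarrow> 0 \<in> U \<Longrightarrow>
      \<exists>V. open V \<and> 0 \<in> V \<and> V \<subseteq> U \<and>
        (\<forall>x\<in>V. \<forall>y\<in>V. \<forall>u\<ge>0. \<forall>v\<ge>0. u + v = 1 \<longrightarrow> u *\<^sub>R x + v *\<^sub>R y \<in> V)"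

lemma convex_nhds_0:
  fixes U :: "'a::locally_convex_space set"
  assumes "open U" "0 \<in> U"
  shows "\<exists>V. open V \<and> convex V \<and> 0 \<in> V \<and> V \<subseteq> U"
  using convex_nhds_0_raw[OF assms] unfolding convex_def by blast

definition lcs_bounded :: "'a::locally_convex_space set \<Rightarrow> bool" where
  "lcs_bounded X \<longleftrightarrow> (\<forall>U. open U \<and> 0 \<in> U \<longrightarrow> (\<exists>r>0. \<forall>t\<ge>r. X \<subseteq> (*\<^sub>R) t ` U))"

text \<open>Duals are sets of functions: \<open>E\<^sup>*\<close> is a set of functions on the whole type, and \<open>E\<^sup>*\<^sup>*\<close> a set
  of functions that carry information on \<open>E\<^sup>*\<close> only (\<^const>\<open>extensional\<close>, so that equality of
  such functions is equality on \<open>E\<^sup>*\<close>).\<close>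

definition cdual :: "('a::locally_convex_space \<Rightarrow> real) set" where
  "cdual = {f. linear f \<and> continuous_on UNIV f}"

definition weakly_bounded :: "'a::locally_convex_space set \<Rightarrow> bool" where
  "weakly_bounded B \<longleftrightarrow> (\<forall>f\<in>cdual. bounded (f ` B))"

text \<open>Uniform convergence on weakly bounded sets, given by its basic neighbourhoods.\<close>

definition cdual_open :: "('a::locally_convex_space \<Rightarrow> real) set \<Rightarrow> bool" where
  "cdual_open W \<longleftrightarrow> W \<subseteq> cdual \<and>
     (\<forall>f\<in>W. \<exists>B e. weakly_bounded B \<and> e > 0 \<and> {g \<in> cdual. \<forall>x\<in>B. \<bar>g x - f x\<bar> < e} \<subseteq> W)"

definition cdual_topology :: "('a::locally_convex_space \<Rightarrow> real) topology" where
  "cdual_topology = topology cdual_open"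

definition cbidual :: "(('a::locally_convex_space \<Rightarrow> real) \<Rightarrow> real) set" where
  "cbidual = {F \<in> extensional cdual.
     (\<forall>f\<in>cdual. \<forall>g\<in>cdual. F (\<lambda>x. f x + g x) = F f + F g) \<and>
     (\<forall>c. \<forall>f\<in>cdual. F (\<lambda>x. c * f x) = c * F f) \<and>
     continuous_map cdual_topology euclideanreal F}"

definition bidual_embedding :: "'a::locally_convex_space \<Rightarrow> ('a \<Rightarrow> real) \<Rightarrow> real" where
  "bidual_embedding x = (\<lambda>f\<in>cdual. f x)"

text \<open>The trace on \<open>X\<close> of the Borel sets of the ambient space is the Borel \<open>\<sigma>\<close>-algebra of the
  subspace \<open>X\<close>.\<close>

definition radon_prob :: "'a::topological_space set \<Rightarrow> 'a measure set" where
  "radon_prob X = {\<mu>. prob_space \<mu> \<and> space \<mu> = X \<and> sets \<mu> = sets (restrict_space borel X) \<and>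
     (\<forall>B\<in>sets \<mu>. emeasure \<mu> B = (SUP K\<in>{K. compact K \<and> K \<subseteq> B}. emeasure \<mu> K))}"

definition barycenter :: "'a::locally_convex_space measure \<Rightarrow> ('a \<Rightarrow> real) \<Rightarrow> real" where
  "barycenter \<mu> = (\<lambda>f\<in>cdual. \<integral>x. f x \<partial>\<mu>)"

definition barycentric :: "'a::locally_convex_space set \<Rightarrow> bool" where
  "barycentric X \<longleftrightarrow> convex X \<and> lcs_bounded X \<and>
     barycenter ` radon_prob X \<subseteq> bidual_embedding ` X"

definition compactly_convex :: "'a::locally_convex_space set \<Rightarrow> bool" where
  "compactly_convex X \<longleftrightarrow> convex X \<and>
     (\<forall>K. compact K \<and> K \<subseteq> X \<longrightarrow> compact (top_of_set X closure_of (convex hull K)))"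


text \<open>Well-definedness: the predicate \<^const>\<open>cdual_open\<close> is a topology, and both maps above
  take values in \<open>E\<^sup>*\<^sup>*\<close>.  The topologies of \<open>E\<^sup>*\<^sup>*\<close> and of the space of Radon probability
  measures do not enter the definition of \<^const>\<open>barycentric\<close>.\<close>

lemma weakly_bounded_Un: "weakly_bounded A \<Longrightarrow> weakly_bounded B \<Longrightarrow> weakly_bounded (A \<union> B)"
  by (auto simp: weakly_bounded_def image_Un)

lemma istopology_cdual_open: "istopology cdual_open"
  unfolding istopology_def
proof (intro conjI allI impI)
  fix S T :: "('a \<Rightarrow> real) set"
  assume S: "cdual_open S" and T: "cdual_open T"
  show "cdual_open (S \<inter> T)"
    unfolding cdual_open_def
  proof (intro conjI ballI)
    show "S \<inter> T \<subseteq> cdual" using S by (auto simp: cdual_open_def)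
  next
    fix f assume f: "f \<in> S \<inter> T"
    obtain A a where A: "weakly_bounded A" "a > 0"
        "{g \<in> cdual. \<forall>x\<in>A. \<bar>g x - f x\<bar> < a} \<subseteq> S"
      using S f unfolding cdual_open_def by blast
    obtain B b where B: "weakly_bounded B" "b > 0"
        "{g \<in> cdual. \<forall>x\<in>B. \<bar>g x - f x\<bar> < b} \<subseteq> T"
      using T f unfolding cdual_open_def by blast
    have "{g \<in> cdual. \<forall>x\<in>A \<union> B. \<bar>g x - f x\<bar> < min a b} \<subseteq> S \<inter> T"
      using A(3) B(3) by auto
    then show "\<exists>B e. weakly_bounded B \<and> e > 0 \<and>
        {g \<in> cdual. \<forall>x\<in>B. \<bar>g x - f x\<bar> < e} \<subseteq> S \<inter> T"
      using weakly_bounded_Un[OF A(1) B(1)] A(2) B(2)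
      by (intro exI[of _ "A \<union> B"] exI[of _ "min a b"]) auto
  qed
next
  fix \<K> :: "('a \<Rightarrow> real) set set"
  assume *: "\<forall>K\<in>\<K>. cdual_open K"
  show "cdual_open (\<Union>\<K>)"
    unfolding cdual_open_def
  proof (intro conjI ballI)
    show "\<Union>\<K> \<subseteq> cdual" using * by (auto simp: cdual_open_def)
  next
    fix f assume "f \<in> \<Union>\<K>"
    then obtain K where K: "K \<in> \<K>" "f \<in> K" by blast
    then obtain B e where "weakly_bounded B" "e > 0"
        "{g \<in> cdual. \<forall>x\<in>B. \<bar>g x - f x\<bar> < e} \<subseteq> K"
      using * unfolding cdual_open_def by blast
    then show "\<exists>B e. weakly_bounded B \<and> e > 0 \<and>
        {g \<in> cdual. \<forall>x\<in>B. \<bar>g x - f x\<bar> < e} \<subseteq> \<Union>\<K>"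
      using K(1) by (meson Union_upper subset_trans)
  qed
qed

lemma openin_cdual_topology: "openin cdual_topology = cdual_open"
  unfolding cdual_topology_def using istopology_cdual_open by (rule topology_inverse')

lemma topspace_cdual_topology: "topspace cdual_topology = cdual"
proof -
  have "weakly_bounded ({} :: 'a set)"
    by (simp add: weakly_bounded_def)
  then have "cdual_open (cdual :: ('a \<Rightarrow> real) set)"
    unfolding cdual_open_def by (auto intro!: exI[of _ "{}"] exI[of _ "1::real"])
  moreover have "cdual_open W \<Longrightarrow> W \<subseteq> cdual" for W :: "('a \<Rightarrow> real) set"
    by (simp add: cdual_open_def)
  ultimately show ?thesis
    unfolding topspace_def openin_cdual_topology by blast
qed

lemma cdual_add: "f \<in> cdual \<Longrightarrow> g \<in> cdual \<Longrightarrow> (\<lambda>x. f x + g x) \<in> cdual"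
  by (auto simp: cdual_def intro: linear_compose_add continuous_on_add)

lemma cdual_scale: "f \<in> cdual \<Longrightarrow> (\<lambda>x. c * f x) \<in> cdual"
  unfolding cdual_def
  by (auto intro!: continuous_intros linearI simp: linear_add linear_scale algebra_simps)

lemma weakly_bounded_if_lcs_bounded:
  assumes "lcs_bounded X" shows "weakly_bounded X"
  unfolding weakly_bounded_def
proof
  fix f :: "'a \<Rightarrow> real" assume f: "f \<in> cdual"
  define U where "U = f -` {-1<..<1}"
  have "open U" using f unfolding U_def cdual_def
    by (auto intro: open_vimage)
  moreover have "0 \<in> U" using f by (simp add: U_def cdual_def linear_0)
  ultimately obtain r where r: "r > 0" "\<And>t. t \<ge> r \<Longrightarrow> X \<subseteq> (*\<^sub>R) t ` U"
    using assms unfolding lcs_bounded_def by meson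
  have "\<bar>f x\<bar> \<le> r" if "x \<in> X" for x
  proof -
    obtain u where u: "u \<in> U" "x = r *\<^sub>R u" using r(2)[of r] \<open>x \<in> X\<close> by auto
    have "\<bar>f x\<bar> = r * \<bar>f u\<bar>" using f r(1) u(2) by (simp add: cdual_def linear_scale abs_mult)
    also have "\<dots> \<le> r * 1" using u(1) r(1) by (intro mult_left_mono) (auto simp: U_def)
    finally show ?thesis by simp
  qed
  then show "bounded (f ` X)" by (auto simp: bounded_iff)
qed

lemma cbidualI:
  fixes F :: "('a::locally_convex_space \<Rightarrow> real) \<Rightarrow> real"
  assumes ext: "F \<in> extensional cdual"
    and add: "\<And>f g. f \<in> cdual \<Longrightarrow> g \<in> cdual \<Longrightarrow> F (\<lambda>x. f x + g x) = F f + F g"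
    and scale: "\<And>c f. f \<in> cdual \<Longrightarrow> F (\<lambda>x. c * f x) = c * F f"
    and B: "weakly_bounded B"
    and bound: "\<And>f e. f \<in> cdual \<Longrightarrow> (\<And>x. x \<in> B \<Longrightarrow> \<bar>f x\<bar> \<le> e) \<Longrightarrow> 0 < e \<Longrightarrow> \<bar>F f\<bar> \<le> e"
  shows "F \<in> cbidual"
proof -
  have "continuous_map cdual_topology euclideanreal F"
    unfolding continuous_map_def
  proof (intro conjI allI impI)
    fix V :: "real set" assume "openin euclideanreal V"
    then have V: "open V" by simp
    have "cdual_open {f \<in> cdual. F f \<in> V}"
      unfolding cdual_open_def
    proof (intro conjI ballI)
      fix f assume f: "f \<in> {f \<in> cdual. F f \<in> V}"
      then obtain e where e: "e > 0" "\<And>y. \<bar>y - F f\<bar> < e \<Longrightarrow> y \<in> V"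
        using V unfolding open_dist dist_real_def by blast
      have "F g \<in> V" if g: "g \<in> cdual" "\<forall>x\<in>B. \<bar>g x - f x\<bar> < e / 2" for g
      proof -
        have f': "(\<lambda>x. -1 * f x) \<in> cdual" using f cdual_scale by blast
        have eq: "F (\<lambda>x. g x + (-1) * f x) = F g - F f"
          using add[OF g(1) f'] scale[of f "-1"] f by simp
        have "\<bar>F (\<lambda>x. g x + (-1) * f x)\<bar> \<le> e / 2"
        proof (rule bound)
          show "(\<lambda>x. g x + (-1) * f x) \<in> cdual" using cdual_add[OF g(1) f'] .
          show "\<bar>g x + (-1) * f x\<bar> \<le> e / 2" if "x \<in> B" for x
            using g(2) that by (simp add: less_imp_le)
          show "0 < e / 2" using e by simp
        qed
        then show ?thesis using e eq by auto
      qed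
      then show "\<exists>B e. weakly_bounded B \<and> e > 0 \<and>
          {g \<in> cdual. \<forall>x\<in>B. \<bar>g x - f x\<bar> < e} \<subseteq> {f \<in> cdual. F f \<in> V}"
        using B e(1) by (intro exI[of _ B] exI[of _ "e / 2"]) auto
    qed auto
    then show "openin cdual_topology {f \<in> topspace cdual_topology. F f \<in> V}"
      by (simp add: openin_cdual_topology topspace_cdual_topology)
  qed simp
  then show ?thesis using ext add scale by (simp add: cbidual_def)
qed

lemma bidual_embedding_in_cbidual: "bidual_embedding x \<in> cbidual"
proof (rule cbidualI[where B = "{x}"])
  show "weakly_bounded {x}" by (simp add: weakly_bounded_def)
qed (auto simp: bidual_embedding_def cdual_add cdual_scale)

lemma integrable_cdual:
  assumes "lcs_bounded X" "\<mu> \<in> radon_prob X" "f \<in> cdual"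
  shows "integrable \<mu> f"
proof -
  interpret prob_space \<mu> using assms(2) by (simp add: radon_prob_def)
  have sp: "space \<mu> = X" and se: "sets \<mu> = sets (restrict_space borel X)"
    using assms(2) by (auto simp: radon_prob_def)
  have "f \<in> borel_measurable borel"
    using assms(3) by (intro borel_measurable_continuous_onI) (simp add: cdual_def)
  then have "f \<in> borel_measurable (restrict_space borel X)"
    by (rule measurable_restrict_space1)
  then have m: "f \<in> borel_measurable \<mu>"
    using measurable_cong_sets[OF se refl] by blast
  obtain M where "\<And>x. x \<in> X \<Longrightarrow> \<bar>f x\<bar> \<le> M"
    using weakly_bounded_if_lcs_bounded[OF assms(1)] assms(3)
    unfolding weakly_bounded_def bounded_iff by fastforce
  then show ?thesis
    by (intro integrable_const_bound[where B = M] m AE_I2) (simp add: sp)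
qed

lemma barycenter_in_cbidual:
  assumes X: "lcs_bounded X" and \<mu>: "\<mu> \<in> radon_prob X"
  shows "barycenter \<mu> \<in> cbidual"
proof (rule cbidualI[where B = X])
  interpret prob_space \<mu> using \<mu> by (simp add: radon_prob_def)
  note int = integrable_cdual[OF X \<mu>]
  show "weakly_bounded X" using X by (rule weakly_bounded_if_lcs_bounded)
  show "barycenter \<mu> \<in> extensional cdual" by (simp add: barycenter_def)
  show "barycenter \<mu> (\<lambda>x. f x + g x) = barycenter \<mu> f + barycenter \<mu> g"
    if "f \<in> cdual" "g \<in> cdual" for f g
    using that int by (simp add: barycenter_def cdual_add)
  show "barycenter \<mu> (\<lambda>x. c * f x) = c * barycenter \<mu> f" if "f \<in> cdual" for c f
    using that by (simp add: barycenter_def cdual_scale)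
  show "\<bar>barycenter \<mu> f\<bar> \<le> e" if f: "f \<in> cdual" and le: "\<And>x. x \<in> X \<Longrightarrow> \<bar>f x\<bar> \<le> e" for f e
  proof -
    have sp: "space \<mu> = X" using \<mu> by (simp add: radon_prob_def)
    have "\<bar>\<integral>x. f x \<partial>\<mu>\<bar> \<le> (\<integral>x. \<bar>f x\<bar> \<partial>\<mu>)" by (rule integral_abs_bound)
    also have "\<dots> \<le> (\<integral>x. e \<partial>\<mu>)"
      using int[OF f] le by (intro integral_mono) (auto simp: sp)
    finally show ?thesis using f by (simp add: barycenter_def prob_space)
  qed
qed

end

theory Submission
  imports Defs
begin

text \<open>Both implications rest on barycenters of measures carried by a compact set \<open>K\<close>.  All that matters
about such a measure is the functional \<open>g \<mapsto> \<integral> g\<close> it defines on the bounded Borel functions on \<open>K\<close>, so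
the argument is phrased for \<^emph>\<open>means\<close>: linear functionals \<open>L\<close> on those functions with \<open>L g \<le> sup g(K)\<close>,
which amount to finitely additive probabilities.  Cutting \<open>K\<close> into finitely many Borel pieces, each
contained in a small translate \<open>a + V\<close> of one of its points, approximates the barycenter of \<open>L\<close> by the
Riemann sum \<open>\<Sum> L(piece) a\<close>, which lies in the convex hull of \<open>K\<close>.  A point of \<open>E\<close> is determined by
the values of the functionals in \<open>E\<^sup>*\<close> at it, and these also detect whether a point lies in a given open
convex neighbourhood of zero; both facts are Hahn-Banach.

Let \<open>X\<close> be barycentric and \<open>K \<subseteq> X\<close> compact.  The means on \<open>K\<close> form a compact set for pointwise
convergence, by Tychonoff's theorem.  On continuous functions each mean agrees with integration against
a Radon measure on \<open>K\<close> (the Riesz representation, \<open>mean_representing_radon_prob\<close>), so by hypothesis it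
has a barycenter in \<open>X\<close>.  The Riemann sums depend continuously on the mean and approximate the
barycenter uniformly, in the original topology of \<open>E\<close>; hence the barycenter map is continuous
(\<open>continuous_on_barycenter\<close>).  Its image is a compact convex subset of \<open>X\<close> containing \<open>K\<close>, and it
therefore contains the closed convex hull of \<open>K\<close>.  This takes place inside \<open>X\<close>; no completion of \<open>E\<close>
is formed.

Conversely let \<open>X\<close> be bounded and compactly convex, and \<open>\<mu>\<close> a Radon probability on \<open>X\<close>.  A mean on a
compact \<open>C \<subseteq> X\<close> has a barycenter in the compact closed convex hull of \<open>C\<close>: the Riemann sums give the
finite intersection property.  Split \<open>\<mu>\<close> into pieces \<open>A\<^sub>0, A\<^sub>1, \<dots>\<close> carried by compact sets, with
\<open>p\<^sub>n = \<mu>(A\<^sub>n) \<le> 4\<^sup>-\<^sup>n\<close> for \<open>n \<ge> 1\<close>, and let \<open>b\<^sub>n \<in> X\<close> be the barycenter of the normalized \<open>n\<close>-th piece.  The barycenter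
of \<open>\<mu>\<close> should be \<open>\<Sum> p\<^sub>n b\<^sub>n\<close>.  Boundedness makes \<open>z\<^sub>n = b\<^sub>0 + 2\<^sup>-\<^sup>n (b\<^sub>n - b\<^sub>0)\<close> converge to \<open>b\<^sub>0\<close>, so these
points of \<open>X\<close> together with \<open>b\<^sub>0\<close> form a compact set, and \<open>p\<^sub>n\<close> is small enough for the partial sums of
\<open>b\<^sub>0 + \<Sum> p\<^sub>n (b\<^sub>n - b\<^sub>0) = b\<^sub>0 + \<Sum> 2\<^sup>n p\<^sub>n (z\<^sub>n - b\<^sub>0)\<close> to lie in its convex hull.  A cluster point of these
partial sums in the compact closed hull is the barycenter (\<open>radon_prob_has_barycenter\<close>).\<close>

section \<open>The Hahn-Banach theorem\<close>

definition sublinear :: "('a::real_vector \<Rightarrow> real) \<Rightarrow> bool" where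
  "sublinear p \<longleftrightarrow> (\<forall>x y. p (x + y) \<le> p x + p y) \<and> (\<forall>c>0. \<forall>x. p (c *\<^sub>R x) = c * p x)"

lemma sublinear_add: "sublinear p \<Longrightarrow> p (x + y) \<le> p x + p y"
  by (simp add: sublinear_def)

lemma sublinear_scale: "sublinear p \<Longrightarrow> 0 < c \<Longrightarrow> p (c *\<^sub>R x) = c * p x"
  by (simp add: sublinear_def)

lemma sublinear_0: "sublinear p \<Longrightarrow> p 0 = 0"
  using sublinear_scale[of p 2 0] by simp

lemma sublinear_ge_minus: "sublinear p \<Longrightarrow> - p (- x) \<le> p x"
  using sublinear_add[of p x "- x"] by (simp add: sublinear_0)

text \<open>A chain of sublinear functionals stays bounded below because \<open>q x \<ge> - q (- x) \<ge> - p (- x)\<close>, and its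
infimum is subadditive because any two members can be replaced by the smaller one.\<close>

lemma sublinear_Inf_chain:
  assumes C: "C \<noteq> {}" "\<And>q. q \<in> C \<Longrightarrow> sublinear q" "\<And>q. q \<in> C \<Longrightarrow> q \<le> p"
    and chain: "\<And>q r. q \<in> C \<Longrightarrow> r \<in> C \<Longrightarrow> q \<le> r \<or> r \<le> q"
  shows "sublinear (\<lambda>x. INF q\<in>C. q x)" "\<And>q. q \<in> C \<Longrightarrow> (\<lambda>x. INF q\<in>C. q x) \<le> q"
proof -
  have bdd: "bdd_below ((\<lambda>q. q x) ` C)" for x
  proof (rule bdd_belowI2)
    fix q assume q: "q \<in> C"
    have "- p (- x) \<le> - q (- x)" using C(3)[OF q] by (simp add: le_fun_def)
    also have "\<dots> \<le> q x" using C(2)[OF q] by (rule sublinear_ge_minus)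
    finally show "- p (- x) \<le> q x" .
  qed
  show lower: "(\<lambda>x. INF q\<in>C. q x) \<le> q" if "q \<in> C" for q
    using cINF_lower[OF bdd that] by (simp add: le_fun_def)
  show "sublinear (\<lambda>x. INF q\<in>C. q x)"
    unfolding sublinear_def
  proof (intro conjI allI impI)
    fix x y
    have "(INF q\<in>C. q (x + y)) \<le> q x + r y" if q: "q \<in> C" and r: "r \<in> C" for q r
    proof -
      obtain s where s: "s \<in> C" "s \<le> q" "s \<le> r" using chain[OF q r] q r by blast
      have "(INF q\<in>C. q (x + y)) \<le> s (x + y)" using lower[OF s(1)] by (simp add: le_fun_def)
      also have "\<dots> \<le> s x + s y" using C(2)[OF s(1)] by (rule sublinear_add)
      also have "\<dots> \<le> q x + r y" using s by (intro add_mono) (auto simp: le_fun_def)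
      finally show ?thesis .
    qed
    then have "(INF q\<in>C. q (x + y)) - r y \<le> (INF q\<in>C. q x)" if "r \<in> C" for r
      using C(1) that by (intro cINF_greatest) (auto simp: diff_le_eq)
    then have "(INF q\<in>C. q (x + y)) - (INF q\<in>C. q x) \<le> (INF r\<in>C. r y)"
      using C(1) by (intro cINF_greatest) (auto simp: diff_le_eq le_diff_eq add.commute)
    then show "(INF q\<in>C. q (x + y)) \<le> (INF q\<in>C. q x) + (INF q\<in>C. q y)" by simp
  next
    have le: "c * (INF q\<in>C. q x) \<le> (INF q\<in>C. q (c *\<^sub>R x))" if "0 < c" for c x
    proof (rule cINF_greatest[OF C(1)])
      fix q assume q: "q \<in> C"
      then have "(INF q\<in>C. q x) \<le> q x" using lower by (simp add: le_fun_def)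
      then show "c * (INF q\<in>C. q x) \<le> q (c *\<^sub>R x)"
        using C(2)[OF q] that by (simp add: sublinear_scale)
    qed
    fix c :: real and x assume c: "0 < c"
    have "inverse c * (INF q\<in>C. q (c *\<^sub>R x)) \<le> (INF q\<in>C. q x)"
      using le[of "inverse c" "c *\<^sub>R x"] c by simp
    then have "(INF q\<in>C. q (c *\<^sub>R x)) \<le> c * (INF q\<in>C. q x)"
      using c by (simp add: field_simps)
    then show "(INF q\<in>C. q (c *\<^sub>R x)) = c * (INF q\<in>C. q x)" using le[OF c, of x] by simp
  qed
qed

text \<open>The largest sublinear minorant of \<open>q\<close> whose value at \<open>- y\<close> is at most \<open>- q y\<close>.  A minimal sublinear
  functional equals all its lowerings, so it is additive.\<close>

definition lowered :: "('a::real_vector \<Rightarrow> real) \<Rightarrow> 'a \<Rightarrow> 'a \<Rightarrow> real" where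
  "lowered q y x = (INF t\<in>{0..}. q (x + t *\<^sub>R y) - t * q y)"

lemma
  assumes q: "sublinear q"
  shows lowered_le: "0 \<le> t \<Longrightarrow> lowered q y x \<le> q (x + t *\<^sub>R y) - t * q y"
    and sublinear_lowered: "sublinear (lowered q y)"
proof -
  have scale0: "q (t *\<^sub>R y) = t * q y" if "0 \<le> t" for t y
    using that q by (cases "t = 0") (auto simp: sublinear_0 sublinear_scale)
  have bdd: "bdd_below ((\<lambda>t. q (x + t *\<^sub>R y) - t * q y) ` {0..})" for x
  proof (rule bdd_belowI2)
    fix t :: real assume "t \<in> {0..}"
    then have "t * q y = q (t *\<^sub>R y)" by (simp add: scale0)
    also have "\<dots> \<le> q (x + t *\<^sub>R y) + q (- x)"
      using sublinear_add[OF q, of "x + t *\<^sub>R y" "- x"] by simp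
    finally show "- q (- x) \<le> q (x + t *\<^sub>R y) - t * q y" by simp
  qed
  show lower: "lowered q y x \<le> q (x + t *\<^sub>R y) - t * q y" if "0 \<le> t" for t x
    unfolding lowered_def using that by (intro cINF_lower bdd) auto
  show "sublinear (lowered q y)"
    unfolding sublinear_def
  proof (intro conjI allI impI)
    fix a b
    have "lowered q y (a + b) \<le> (q (a + s *\<^sub>R y) - s * q y) + (q (b + t *\<^sub>R y) - t * q y)"
      if "0 \<le> s" "0 \<le> t" for s t
    proof -
      have "lowered q y (a + b) \<le> q ((a + b) + (s + t) *\<^sub>R y) - (s + t) * q y"
        using that by (intro lower) simp
      also have "(a + b) + (s + t) *\<^sub>R y = (a + s *\<^sub>R y) + (b + t *\<^sub>R y)"
        by (simp add: algebra_simps)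
      also have "q \<dots> \<le> q (a + s *\<^sub>R y) + q (b + t *\<^sub>R y)" by (rule sublinear_add[OF q])
      finally show ?thesis by (simp add: algebra_simps)
    qed
    then have "lowered q y (a + b) - (q (b + t *\<^sub>R y) - t * q y) \<le> lowered q y a" if "0 \<le> t" for t
      using that unfolding lowered_def[of q y a] by (intro cINF_greatest) (auto simp: diff_le_eq)
    then have "lowered q y (a + b) - lowered q y a \<le> q (b + t *\<^sub>R y) - t * q y" if "0 \<le> t" for t
      using that by (simp add: algebra_simps)
    then have "lowered q y (a + b) - lowered q y a \<le> lowered q y b"
      unfolding lowered_def[of q y b] by (intro cINF_greatest) auto
    then show "lowered q y (a + b) \<le> lowered q y a + lowered q y b" by simp
  next
    have le: "lowered q y (c *\<^sub>R a) \<le> c * lowered q y a" if c: "0 < c" for c a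
    proof -
      have "inverse c * lowered q y (c *\<^sub>R a) \<le> lowered q y a"
        unfolding lowered_def[of q y a]
      proof (rule cINF_greatest)
        fix t :: real assume t: "t \<in> {0..}"
        have "lowered q y (c *\<^sub>R a) \<le> q (c *\<^sub>R a + (c * t) *\<^sub>R y) - (c * t) * q y"
          using t c by (intro lower) simp
        also have "c *\<^sub>R a + (c * t) *\<^sub>R y = c *\<^sub>R (a + t *\<^sub>R y)" by (simp add: algebra_simps)
        also have "q \<dots> = c * q (a + t *\<^sub>R y)" using q c by (rule sublinear_scale)
        finally show "inverse c * lowered q y (c *\<^sub>R a) \<le> q (a + t *\<^sub>R y) - t * q y"
          using c by (simp add: field_simps)
      qed simp
      then show ?thesis using c by (simp add: field_simps)
    qed
    fix c :: real and a assume c: "0 < c"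
    have "lowered q y (inverse c *\<^sub>R (c *\<^sub>R a)) \<le> inverse c * lowered q y (c *\<^sub>R a)"
      using c by (intro le) simp
    then have "c * lowered q y a \<le> lowered q y (c *\<^sub>R a)" using c by (simp add: field_simps)
    then show "lowered q y (c *\<^sub>R a) = c * lowered q y a" using le[OF c, of a] by simp
  qed
qed

text \<open>Zorn's lemma is applied to the sublinear functionals below \<open>lowered p x0\<close> rather than to partial linear
extensions: a minimal one is linear, and the bound \<open>lowered p x0 (- x0) \<le> - p x0\<close> forces equality at
\<open>x0\<close>.\<close>

theorem Hahn_Banach_dominated:
  assumes p: "sublinear p"
  obtains f where "linear f" "\<And>x. f x \<le> p x" "f x0 = p x0"
proof -
  define A where "A = {q. sublinear q \<and> q \<le> lowered p x0}"
  have low: "sublinear (lowered p x0)" by (rule sublinear_lowered[OF p])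
  have "\<exists>m\<in>A. \<forall>a\<in>A. a \<le> m \<longrightarrow> a = m"
  proof (rule predicate_Zorn[where P = "\<lambda>q r. r \<le> q"])
    show "partial_order_on A (relation_of (\<lambda>q r. r \<le> q) A)"
      by (rule partial_order_on_relation_ofI) auto
    fix C assume "C \<in> Chains (relation_of (\<lambda>q r. r \<le> q) A)"
    then have CA: "C \<subseteq> A" and chain: "\<And>q r. q \<in> C \<Longrightarrow> r \<in> C \<Longrightarrow> q \<le> r \<or> r \<le> q"
      unfolding Chains_def relation_of_def by blast+
    show "\<exists>u\<in>A. \<forall>a\<in>C. u \<le> a"
    proof (cases "C = {}")
      case True
      then show ?thesis using low unfolding A_def by auto
    next
      case False
      have C: "\<And>q. q \<in> C \<Longrightarrow> sublinear q" "\<And>q. q \<in> C \<Longrightarrow> q \<le> lowered p x0"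
        using CA unfolding A_def by blast+
      note inf = sublinear_Inf_chain[OF False C chain]
      obtain q where "q \<in> C" using False by blast
      then have "(\<lambda>x. INF q\<in>C. q x) \<le> lowered p x0" using inf(2) C(2) order_trans by blast
      then show ?thesis using inf unfolding A_def by blast
    qed
  qed
  then obtain m where m: "sublinear m" "m \<le> lowered p x0"
    and min: "\<And>a. sublinear a \<Longrightarrow> a \<le> m \<Longrightarrow> a = m"
    unfolding A_def by (metis (mono_tags, lifting) mem_Collect_eq order_trans)
  have "lowered m y = m" for y
    using lowered_le[OF m(1), of 0 y] by (intro min sublinear_lowered m(1)) (simp add: le_fun_def)
  then have add: "m (x + y) = m x + m y" for x y
    using lowered_le[OF m(1), of 1 y x] sublinear_add[OF m(1), of x y] by simp
  have neg: "m (- x) = - m x" for x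
    using add[of x "- x"] by (simp add: sublinear_0[OF m(1)])
  have "linear m"
  proof (rule linearI)
    fix c x
    show "m (c *\<^sub>R x) = c *\<^sub>R m x"
    proof (cases c "0::real" rule: linorder_cases)
      case less
      then have "m (- (c *\<^sub>R x)) = - c * m x"
        using sublinear_scale[OF m(1), of "- c" x] by simp
      then show ?thesis by (simp add: neg)
    qed (simp_all add: sublinear_0 sublinear_scale m(1))
  qed (rule add)
  moreover have le: "m x \<le> p x" for x
    using m(2) lowered_le[OF p, of 0 x0 x] by (simp add: le_fun_def) (metis order_trans)
  moreover have "m (- x0) \<le> - p x0"
    using m(2) lowered_le[OF p, of 1 x0 "- x0"] sublinear_0[OF p]
    by (simp add: le_fun_def) (metis order_trans)
  then have "m x0 = p x0" using le[of x0] by (simp add: neg)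
  ultimately show thesis by (rule that)
qed

section \<open>Separation in locally convex spaces\<close>

lemma tendsto_scaleR_lcs:
  fixes g :: "'b \<Rightarrow> 'a::locally_convex_space"
  assumes "(f \<longlongrightarrow> c) F" "(g \<longlongrightarrow> x) F"
  shows "((\<lambda>t. f t *\<^sub>R g t) \<longlongrightarrow> c *\<^sub>R x) F"
  using filterlim_compose[OF tendsto_scaleR_nhds filterlim_Pair[OF assms]] by simp

lemma continuous_on_scaleR_lcs:
  fixes g :: "'b::topological_space \<Rightarrow> 'a::locally_convex_space"
  assumes "continuous_on S f" "continuous_on S g"
  shows "continuous_on S (\<lambda>t. f t *\<^sub>R g t)"
  using assms unfolding continuous_on_def by (blast intro: tendsto_scaleR_lcs)

definition minkowski :: "'a::real_vector set \<Rightarrow> 'a \<Rightarrow> real" where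
  "minkowski V x = Inf {t. 0 < t \<and> inverse t *\<^sub>R x \<in> V}"

lemma
  fixes V :: "'a::locally_convex_space set"
  assumes V: "open V" "convex V" "0 \<in> V"
  shows sublinear_minkowski: "sublinear (minkowski V)"
    and minkowski_less_1_iff: "minkowski V x < 1 \<longleftrightarrow> x \<in> V"
proof -
  define G where "G x = {t. 0 < t \<and> inverse t *\<^sub>R x \<in> V}" for x
  have bdd: "bdd_below (G x)" for x unfolding G_def by (rule bdd_belowI[of _ 0]) auto
  have absorb: "\<exists>e>0. \<forall>t. \<bar>t - c\<bar> < e \<longrightarrow> t *\<^sub>R x \<in> V" if "c *\<^sub>R x \<in> V" for c x
  proof -
    have "continuous_on UNIV (\<lambda>t. t *\<^sub>R x)" by (intro continuous_on_scaleR_lcs continuous_intros)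
    then have "open ((\<lambda>t. t *\<^sub>R x) -` V)" using V(1) by (simp add: open_vimage)
    then show ?thesis using that unfolding open_dist dist_real_def by fastforce
  qed
  have ne: "G x \<noteq> {}" for x
  proof -
    obtain e where "e > 0" "\<And>t. \<bar>t\<bar> < e \<Longrightarrow> t *\<^sub>R x \<in> V" using absorb[of 0 x] V(3) by auto
    then have "inverse (2 / e) *\<^sub>R x \<in> V" by simp
    then show ?thesis using \<open>e > 0\<close> unfolding G_def by (intro ex_in_conv[THEN iffD1] exI[of _ "2 / e"]) simp
  qed
  have minkowski: "minkowski V x = Inf (G x)" for x by (simp add: minkowski_def G_def)
  have lower: "minkowski V x \<le> t" if "t \<in> G x" for x t
    unfolding minkowski using that by (intro cInf_lower bdd)
  have greatest: "a \<le> minkowski V x" if "\<And>t. t \<in> G x \<Longrightarrow> a \<le> t" for a x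
    unfolding minkowski using ne that by (intro cInf_greatest) auto
  show "minkowski V x < 1 \<longleftrightarrow> x \<in> V"
  proof
    assume "minkowski V x < 1"
    then obtain t where t: "t \<in> G x" "t < 1" using greatest[of x 1] by fastforce
    then have "t *\<^sub>R (inverse t *\<^sub>R x) + (1 - t) *\<^sub>R 0 \<in> V"
      using V unfolding G_def by (intro convexD) auto
    then show "x \<in> V" using t unfolding G_def by simp
  next
    assume "x \<in> V"
    then obtain e where e: "e > 0" "\<And>t. \<bar>t - 1\<bar> < e \<Longrightarrow> t *\<^sub>R x \<in> V" using absorb[of 1 x] by auto
    then have "inverse (inverse (1 + e / 2)) *\<^sub>R x \<in> V" by simp
    then have "minkowski V x \<le> inverse (1 + e / 2)" using e(1) by (intro lower) (simp add: G_def)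
    also have "\<dots> < 1" using e(1) by (simp add: field_simps)
    finally show "minkowski V x < 1" .
  qed
  show "sublinear (minkowski V)"
    unfolding sublinear_def
  proof (intro conjI allI impI)
    fix x y
    have "minkowski V (x + y) \<le> s + t" if s: "s \<in> G x" and t: "t \<in> G y" for s t
    proof (rule lower)
      have pos: "0 < s" "0 < t" using s t by (auto simp: G_def)
      have "(s / (s + t)) *\<^sub>R (inverse s *\<^sub>R x) + (t / (s + t)) *\<^sub>R (inverse t *\<^sub>R y) \<in> V"
        using V(2) s t unfolding G_def
        by (intro convexD) (auto simp: add_divide_distrib[symmetric])
      moreover have "(s / (s + t)) *\<^sub>R (inverse s *\<^sub>R x) + (t / (s + t)) *\<^sub>R (inverse t *\<^sub>R y)
          = inverse (s + t) *\<^sub>R (x + y)"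
      proof -
        have "s / (s + t) * inverse s = inverse (s + t)" "t / (s + t) * inverse t = inverse (s + t)"
          using pos by (simp_all add: field_simps)
        then show ?thesis by (simp only: scaleR_scaleR scaleR_add_right)
      qed
      ultimately show "s + t \<in> G (x + y)" using pos by (simp add: G_def)
    qed
    then have "minkowski V (x + y) - t \<le> minkowski V x" if "t \<in> G y" for t
      using that by (intro greatest) (simp add: diff_le_eq)
    then have "minkowski V (x + y) - minkowski V x \<le> minkowski V y"
      by (intro greatest) (simp add: diff_le_eq add.commute)
    then show "minkowski V (x + y) \<le> minkowski V x + minkowski V y" by simp
  next
    have le: "minkowski V (c *\<^sub>R x) \<le> c * minkowski V x" if c: "0 < c" for c x
    proof -
      have "inverse c * minkowski V (c *\<^sub>R x) \<le> minkowski V x"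
      proof (rule greatest)
        fix t assume t: "t \<in> G x"
        moreover have "inverse (c * t) *\<^sub>R (c *\<^sub>R x) = inverse t *\<^sub>R x" using c by simp
        ultimately have "inverse (c * t) *\<^sub>R (c *\<^sub>R x) \<in> V" by (simp only: G_def mem_Collect_eq)
        then have "minkowski V (c *\<^sub>R x) \<le> c * t" using c t by (intro lower) (simp add: G_def)
        then show "inverse c * minkowski V (c *\<^sub>R x) \<le> t" using c by (simp add: field_simps)
      qed
      then show ?thesis using c by (simp add: field_simps)
    qed
    fix c :: real and x assume c: "0 < c"
    have "minkowski V (inverse c *\<^sub>R (c *\<^sub>R x)) \<le> inverse c * minkowski V (c *\<^sub>R x)"
      using c by (intro le) simp
    then have "c * minkowski V x \<le> minkowski V (c *\<^sub>R x)" using c by (simp add: field_simps)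
    then show "minkowski V (c *\<^sub>R x) = c * minkowski V x" using le[OF c, of x] by simp
  qed
qed

text \<open>The Minkowski functional of \<open>V\<close> is sublinear and is less than 1 exactly on \<open>V\<close>, so the functional that
Hahn-Banach produces below it, equal to it at \<open>x\<close>, separates.  Continuity is automatic, since the
functional is less than 1 on a neighbourhood of zero.\<close>

theorem separation_open_convex:
  fixes V :: "'a::locally_convex_space set"
  assumes V: "open V" "convex V" "0 \<in> V" and x: "x \<notin> V"
  obtains f where "f \<in> cdual" "\<And>v. v \<in> V \<Longrightarrow> f v < 1" "1 \<le> f x"
proof -
  obtain f where f: "linear f" "\<And>y. f y \<le> minkowski V y" "f x = minkowski V x"
    using Hahn_Banach_dominated[OF sublinear_minkowski[OF V]] by blast
  have less: "f v < 1" if "v \<in> V" for v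
    using f(2)[of v] minkowski_less_1_iff[OF V, of v] that by simp
  \<comment> \<open>The set \<open>e (V \<inter> - V)\<close> is a neighbourhood of zero on which \<open>\<bar>f\<bar> < e\<close>.\<close>
  have "continuous_on UNIV f"
    unfolding continuous_on_def
  proof (intro ballI tendstoI)
    fix y :: 'a and e :: real assume e: "0 < e"
    have lim: "((\<lambda>z. c *\<^sub>R (z - y)) \<longlongrightarrow> 0) (at y)" for c
    proof -
      have "((\<lambda>z. c *\<^sub>R (z - y)) \<longlongrightarrow> c *\<^sub>R (y - y)) (at y)"
        by (intro tendsto_scaleR_lcs tendsto_diff tendsto_ident_at tendsto_const)
      then show ?thesis by simp
    qed
    have "\<forall>\<^sub>F z in at y. inverse e *\<^sub>R (z - y) \<in> V"
      using topological_tendstoD[OF lim[of "inverse e"] V(1,3)] .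
    moreover have "\<forall>\<^sub>F z in at y. (- inverse e) *\<^sub>R (z - y) \<in> V"
      using topological_tendstoD[OF lim[of "- inverse e"] V(1,3)] .
    ultimately show "\<forall>\<^sub>F z in at y. dist (f z) (f y) < e"
    proof eventually_elim
      case (elim z)
      have "f (inverse e *\<^sub>R (z - y)) < 1" "f ((- inverse e) *\<^sub>R (z - y)) < 1"
        using elim by (blast intro: less)+
      then have "\<bar>inverse e * (f z - f y)\<bar> < 1"
        by (simp add: linear_scale[OF f(1)] linear_diff[OF f(1)] linear_neg[OF f(1)])
      then show ?case using e by (simp add: abs_mult dist_real_def field_simps)
    qed
  qed
  then show thesis using that f less minkowski_less_1_iff[OF V, of x] x
    by (auto simp: cdual_def)
qed

lemma cdual_separates_points:
  fixes x y :: "'a::locally_convex_space"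
  assumes eq: "\<And>f. f \<in> cdual \<Longrightarrow> f x = f y"
  shows "x = y"
proof (rule ccontr)
  assume "x \<noteq> y"
  then obtain U where U: "open U" "0 \<in> U" "x - y \<notin> U"
    using t1_space[of 0 "x - y"] by auto
  obtain V where V: "open V" "convex V" "0 \<in> V" "V \<subseteq> U" using convex_nhds_0[OF U(1,2)] by blast
  obtain f where f: "f \<in> cdual" "1 \<le> f (x - y)"
    using separation_open_convex[OF V(1-3), of "x - y"] V(4) U(3) by blast
  then show False using eq[OF f(1)] by (simp add: cdual_def linear_diff)
qed


section \<open>Means on compact sets\<close>

definition bdd_borel :: "'a::topological_space set \<Rightarrow> ('a \<Rightarrow> real) set" where
  "bdd_borel K = {g \<in> borel_measurable borel. bounded (g ` K)}"

lemma bdd_borel_add: "g \<in> bdd_borel K \<Longrightarrow> h \<in> bdd_borel K \<Longrightarrow> (\<lambda>x. g x + h x) \<in> bdd_borel K"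
  unfolding bdd_borel_def by (auto intro: bounded_plus_comp)

lemma bdd_borel_cmult:
  assumes "g \<in> bdd_borel K" shows "(\<lambda>x. c * g x) \<in> bdd_borel K"
proof -
  obtain M where "\<And>x. x \<in> K \<Longrightarrow> \<bar>g x\<bar> \<le> M"
    using assms unfolding bdd_borel_def bounded_iff by auto
  then have "\<And>x. x \<in> K \<Longrightarrow> \<bar>c * g x\<bar> \<le> \<bar>c\<bar> * M"
    by (simp add: abs_mult mult_left_mono)
  then show ?thesis using assms unfolding bdd_borel_def bounded_iff by auto
qed

lemma bdd_borel_const: "(\<lambda>x. c) \<in> bdd_borel K"
  unfolding bdd_borel_def bounded_iff by auto

lemma bdd_borel_indicator: "A \<in> sets borel \<Longrightarrow> indicator A \<in> bdd_borel K"
  unfolding bdd_borel_def bounded_iff by (auto intro!: exI[of _ 1] simp: indicator_def)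

lemma bdd_borel_sum: "(\<And>i. i \<in> I \<Longrightarrow> g i \<in> bdd_borel K) \<Longrightarrow> (\<lambda>x. \<Sum>i\<in>I. g i x) \<in> bdd_borel K"
  by (induction I rule: infinite_finite_induct) (auto simp: bdd_borel_const bdd_borel_add)

lemma bdd_borel_continuous:
  assumes "compact K" "continuous_on UNIV g"
  shows "g \<in> bdd_borel K"
  using assms compact_continuous_image[of K g] continuous_on_subset[of UNIV g K]
  unfolding bdd_borel_def by (auto intro: borel_measurable_continuous_onI compact_imp_bounded)

lemma bdd_borel_cdual: "compact K \<Longrightarrow> f \<in> cdual \<Longrightarrow> f \<in> bdd_borel K"
  by (simp add: bdd_borel_continuous cdual_def)

text \<open>Values of \<open>L\<close> outside \<open>bdd_borel K\<close> are unconstrained.  The third condition alone carries positivity,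
normalization and concentration on \<open>K\<close>; on indicators \<open>L\<close> is a finitely additive probability.  If \<open>K\<close> is
empty there is no mean.\<close>

definition mean :: "'a::topological_space set \<Rightarrow> (('a \<Rightarrow> real) \<Rightarrow> real) \<Rightarrow> bool" where
  "mean K L \<longleftrightarrow>
     (\<forall>g\<in>bdd_borel K. \<forall>h\<in>bdd_borel K. L (\<lambda>x. g x + h x) = L g + L h) \<and>
     (\<forall>c. \<forall>g\<in>bdd_borel K. L (\<lambda>x. c * g x) = c * L g) \<and>
     (\<forall>c. \<forall>g\<in>bdd_borel K. (\<forall>x\<in>K. g x \<le> c) \<longrightarrow> L g \<le> c)"

context
  fixes K :: "'a::topological_space set" and L
  assumes L: "mean K L"
begin

lemma mean_add: "g \<in> bdd_borel K \<Longrightarrow> h \<in> bdd_borel K \<Longrightarrow> L (\<lambda>x. g x + h x) = L g + L h"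
  using L by (simp add: mean_def)

lemma mean_cmult: "g \<in> bdd_borel K \<Longrightarrow> L (\<lambda>x. c * g x) = c * L g"
  using L by (simp add: mean_def)

lemma mean_le: "g \<in> bdd_borel K \<Longrightarrow> (\<And>x. x \<in> K \<Longrightarrow> g x \<le> c) \<Longrightarrow> L g \<le> c"
  using L by (simp add: mean_def)

lemma mean_diff: 
  assumes "g \<in> bdd_borel K" "h \<in> bdd_borel K"
  shows "L (\<lambda>x. g x - h x) = L g - L h"
  using mean_add[OF assms(1) bdd_borel_cmult[OF assms(2), of "-1"]] mean_cmult[OF assms(2), of "-1"]
  by simp

lemma mean_mono:
  assumes "g \<in> bdd_borel K" "h \<in> bdd_borel K" "\<And>x. x \<in> K \<Longrightarrow> g x \<le> h x"
  shows "L g \<le> L h"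
proof -
  have "(\<lambda>x. g x - h x) \<in> bdd_borel K"
    using bdd_borel_add[OF assms(1) bdd_borel_cmult[OF assms(2), of "-1"]] by simp
  then have "L (\<lambda>x. g x - h x) \<le> 0" using assms(3) by (intro mean_le) auto
  then show ?thesis using mean_diff[OF assms(1,2)] by simp
qed

lemma mean_const: "L (\<lambda>x. c) = c"
proof (rule antisym)
  show "L (\<lambda>x. c) \<le> c" by (intro mean_le bdd_borel_const) auto
  have "L (\<lambda>x. - c) \<le> - c" by (intro mean_le bdd_borel_const) auto
  then show "c \<le> L (\<lambda>x. c)" using mean_cmult[OF bdd_borel_const, of "-1" c] by simp
qed

lemma mean_ge: "g \<in> bdd_borel K \<Longrightarrow> (\<And>x. x \<in> K \<Longrightarrow> c \<le> g x) \<Longrightarrow> c \<le> L g"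
  using mean_mono[OF bdd_borel_const, of g c] by (simp add: mean_const)

lemma mean_sum:
  assumes "\<And>i. i \<in> I \<Longrightarrow> g i \<in> bdd_borel K"
  shows "L (\<lambda>x. \<Sum>i\<in>I. g i x) = (\<Sum>i\<in>I. L (g i))"
  using assms
  by (induction I rule: infinite_finite_induct) (simp_all add: mean_const mean_add bdd_borel_sum)

end

lemma mean_evaluation: "x \<in> K \<Longrightarrow> mean K (\<lambda>g. g x)"
  by (simp add: mean_def)

lemma mean_convex_combination:
  assumes "mean K L" "mean K L'" "0 \<le> u" "0 \<le> v" "u + v = (1::real)"
  shows "mean K (\<lambda>g. u * L g + v * L' g)"
  unfolding mean_def
proof (intro conjI allI ballI impI)
  fix c g assume "g \<in> bdd_borel K" "\<forall>x\<in>K. g x \<le> c"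
  then have "L g \<le> c" "L' g \<le> c" using mean_le assms(1,2) by blast+
  then have "u * L g + v * L' g \<le> u * c + v * c"
    using assms(3,4) by (intro add_mono mult_left_mono)
  also have "\<dots> = c" using assms(5) by (simp add: distrib_right[symmetric])
  finally show "u * L g + v * L' g \<le> c" .
qed (simp_all add: mean_add[OF assms(1)] mean_add[OF assms(2)] mean_cmult[OF assms(1)]
      mean_cmult[OF assms(2)] algebra_simps)

section \<open>Riemann sums\<close>

text \<open>The fibres of \<open>r\<close> are a Borel partition into pieces whose parts in \<open>K\<close> lie in translates of \<open>V\<close>; each piece
is represented by its tag in \<open>K\<close>.\<close>

definition tagging :: "'a::locally_convex_space set \<Rightarrow> 'a set \<Rightarrow> 'a set \<Rightarrow> ('a \<Rightarrow> 'a) \<Rightarrow> bool" where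
  "tagging K V F r \<longleftrightarrow> finite F \<and> F \<subseteq> K \<and> (\<forall>x\<in>K. r x \<in> F \<and> x - r x \<in> V) \<and>
     (\<forall>a. {x. r x = a} \<in> sets borel)"

definition riemann_sum :: "(('a::real_vector \<Rightarrow> real) \<Rightarrow> real) \<Rightarrow> 'a set \<Rightarrow> ('a \<Rightarrow> 'a) \<Rightarrow> 'a" where
  "riemann_sum L F r = (\<Sum>a\<in>F. L (indicator {x. r x = a}) *\<^sub>R a)"

lemma tagging_exists:
  fixes K :: "'a::locally_convex_space set"
  assumes K: "compact K" and V: "open V" "0 \<in> V"
  obtains F r where "tagging K V F r"
proof -
  define U where "U a = {x. x - a \<in> V}" for a
  have U: "open (U a)" for a
  proof -
    have "open ((\<lambda>x. x - a) -` V)"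
      by (intro open_vimage V(1) continuous_intros)
    then show ?thesis by (simp add: U_def vimage_def)
  qed
  have "K \<subseteq> (\<Union>a\<in>K. U a)" using V(2) by (auto simp: U_def)
  then obtain F where F: "F \<subseteq> K" "finite F" "K \<subseteq> (\<Union>a\<in>F. U a)"
    using compactE_image[OF K, of K U] U by blast
  \<comment> \<open>Each point is tagged by the first member of \<open>F\<close> that is close to it.\<close>
  have "\<exists>r. (\<forall>x\<in>(\<Union>a\<in>F. U a). r x \<in> F \<and> x \<in> U (r x)) \<and> (\<forall>a. {x. r x = a} \<in> sets borel)"
    using F(2)
  proof induction
    case empty
    then show ?case by (intro exI[of _ "\<lambda>_. 0"]) auto
  next
    case (insert b F)
    then obtain r where r: "\<And>x. x \<in> (\<Union>a\<in>F. U a) \<Longrightarrow> r x \<in> F \<and> x \<in> U (r x)"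
      "\<And>a. {x. r x = a} \<in> sets borel"
      by blast
    define s where "s x = (if x \<in> U b then b else r x)" for x
    have "{x. s x = a} = (if a = b then U b else {}) \<union> ({x. r x = a} - U b)" for a
      by (auto simp: s_def)
    then have "{x. s x = a} \<in> sets borel" for a using r(2) U by simp
    then show ?case using r(1) by (intro exI[of _ s]) (auto simp: s_def)
  qed
  then obtain r where "\<And>x. x \<in> (\<Union>a\<in>F. U a) \<Longrightarrow> r x \<in> F \<and> x \<in> U (r x)"
      "\<And>a. {x. r x = a} \<in> sets borel" by blast
  then have "tagging K V F r" using F unfolding tagging_def U_def by blast
  then show thesis by (rule that)
qed

lemma riemann_sum_in_convex_hull:
  assumes L: "mean K L" and r: "tagging K V F r"
  shows "riemann_sum L F r \<in> convex hull K"
  unfolding riemann_sum_def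
proof (rule convex_sum)
  have sets: "{x. r x = a} \<in> sets borel" for a using r by (simp add: tagging_def)
  show "finite F" using r by (simp add: tagging_def)
  show "a \<in> convex hull K" if "a \<in> F" for a
    using that r hull_inc[of a K convex] by (auto simp: tagging_def)
  show "0 \<le> L (indicator {x. r x = a})" for a
    using sets by (intro mean_ge[OF L] bdd_borel_indicator) auto
  have "L (\<lambda>x. \<Sum>a\<in>F. indicator {x. r x = a} x) = 1"
  proof (rule antisym)
    have one: "(\<Sum>a\<in>F. indicator {x. r x = a} x) = (1::real)" if "x \<in> K" for x
    proof -
      have "finite F" "r x \<in> F" using that r by (auto simp: tagging_def)
      then show ?thesis by (simp add: indicator_def)
    qed
    show "L (\<lambda>x. \<Sum>a\<in>F. indicator {x. r x = a} x) \<le> 1"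
      using one sets by (intro mean_le[OF L] bdd_borel_sum bdd_borel_indicator) auto
    show "1 \<le> L (\<lambda>x. \<Sum>a\<in>F. indicator {x. r x = a} x)"
      using one sets by (intro mean_ge[OF L] bdd_borel_sum bdd_borel_indicator) auto
  qed
  then show "(\<Sum>a\<in>F. L (indicator {x. r x = a})) = 1"
    by (simp add: mean_sum[OF L, OF bdd_borel_indicator[OF sets]])
qed (rule convex_convex_hull)

text \<open>On \<open>K\<close> the functional \<open>f\<close> exceeds the step function \<open>f \<circ> r\<close> by at most \<open>e\<close>, and \<open>L\<close> maps that step
function to the value of \<open>f\<close> at the Riemann sum.  The estimate is one-sided so that it can be used both
with functionals small on \<open>V\<close> and with those bounded only from above there.\<close>

lemma mean_le_riemann_sum:
  assumes L: "mean K L" and r: "tagging K V F r" and K: "compact K" and f: "f \<in> cdual"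
    and e: "\<And>v. v \<in> V \<Longrightarrow> f v \<le> e"
  shows "L f \<le> f (riemann_sum L F r) + e"
proof -
  have sets: "{x. r x = a} \<in> sets borel" for a using r by (simp add: tagging_def)
  have lin: "linear f" using f by (simp add: cdual_def)
  have fB: "f \<in> bdd_borel K" using K f by (rule bdd_borel_cdual)
  have summand: "(\<lambda>x. f a * indicator {x. r x = a} x) \<in> bdd_borel K" for a
    using sets by (intro bdd_borel_cmult bdd_borel_indicator)
  have "L f \<le> L (\<lambda>x. (\<Sum>a\<in>F. f a * indicator {x. r x = a} x) + e)"
  proof (rule mean_mono[OF L fB])
    show "(\<lambda>x. (\<Sum>a\<in>F. f a * indicator {x. r x = a} x) + e) \<in> bdd_borel K"
      by (intro bdd_borel_add bdd_borel_sum summand bdd_borel_const)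
    fix x assume x: "x \<in> K"
    have "(\<Sum>a\<in>F. f a * indicator {x. r x = a} x) = (\<Sum>a\<in>F. if r x = a then f a else 0)"
      by (intro sum.cong) auto
    also have "\<dots> = f (r x)"
    proof -
      have "finite F" "r x \<in> F" using x r by (auto simp: tagging_def)
      then show ?thesis by simp
    qed
    finally show "f x \<le> (\<Sum>a\<in>F. f a * indicator {x. r x = a} x) + e"
      using e[of "x - r x"] x r by (simp add: tagging_def linear_diff[OF lin])
  qed
  also have "\<dots> = (\<Sum>a\<in>F. f a * L (indicator {x. r x = a})) + e"
    using summand bdd_borel_indicator[OF sets]
    by (subst mean_add[OF L]) (auto simp: mean_sum[OF L] mean_const[OF L] mean_cmult[OF L]
        intro: bdd_borel_sum bdd_borel_const)
  also have "\<dots> = f (riemann_sum L F r) + e"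
    by (simp add: riemann_sum_def linear_sum[OF lin] linear_scale[OF lin] mult.commute)
  finally show ?thesis .
qed

text \<open>For finitely many functionals a Riemann sum comes within any prescribed error of the required values;
compactness of \<open>D\<close> passes to all functionals at once.\<close>

lemma mean_barycenter_in_compact:
  fixes K :: "'a::locally_convex_space set"
  assumes L: "mean K L" and K: "compact K" and D: "compact D" "convex hull K \<subseteq> D"
  obtains x where "x \<in> D" "\<And>f. f \<in> cdual \<Longrightarrow> f x = L f"
proof -
  define I :: "(('a \<Rightarrow> real) \<times> real) set" where "I = cdual \<times> {0<..}"
  define C where "C = (\<lambda>(f, e). {x. \<bar>f x - L f\<bar> \<le> e} :: 'a set)"
  have "D \<inter> (\<Inter>i\<in>I. C i) \<noteq> {}"
  proof (rule compact_imp_fip_image[OF D(1)])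
    fix i assume "i \<in> I"
    then obtain f e where i: "i = (f, e)" "f \<in> cdual" by (auto simp: I_def)
    then have "closed {x. \<bar>f x - L f\<bar> \<le> e}"
      by (intro closed_Collect_le continuous_intros) (auto simp: cdual_def)
    then show "closed (C i)" by (simp add: C_def i)
  next
    fix J assume J: "finite J" "J \<subseteq> I"
    define V where "V = (\<Inter>(f, e)\<in>J. {v. \<bar>f v\<bar> < e})"
    have "open {v. \<bar>f v\<bar> < e}" if "(f, e) \<in> J" for f e
      using that J(2) by (intro open_Collect_less continuous_intros) (auto simp: I_def cdual_def)
    then have "open V" unfolding V_def using J(1) by (intro open_INT) auto
    moreover have "0 \<in> V"
      using J(2) by (auto simp: V_def I_def cdual_def linear_0)
    ultimately obtain F r where r: "tagging K V F r" using tagging_exists[OF K] by blast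
    have "riemann_sum L F r \<in> C i" if i: "i \<in> J" for i
    proof -
      obtain f e where fe: "i = (f, e)" "f \<in> cdual" using i J(2) by (auto simp: I_def)
      have v: "\<bar>f v\<bar> \<le> e" if "v \<in> V" for v
        using that i fe by (auto simp: V_def)
      have "L f \<le> f (riemann_sum L F r) + e"
        using v by (intro mean_le_riemann_sum[OF L r K fe(2)]) (auto simp: abs_le_iff)
      moreover have "L (\<lambda>x. -1 * f x) \<le> -1 * f (riemann_sum L F r) + e"
        using v by (intro mean_le_riemann_sum[OF L r K cdual_scale[OF fe(2)]]) (auto simp: abs_le_iff)
      ultimately show ?thesis
        using mean_cmult[OF L bdd_borel_cdual[OF K fe(2)], of "-1"] by (simp add: C_def fe abs_le_iff)
    qed
    moreover have "riemann_sum L F r \<in> D" using riemann_sum_in_convex_hull[OF L r] D(2) by blast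
    ultimately show "D \<inter> (\<Inter>i\<in>J. C i) \<noteq> {}" by blast
  qed
  then obtain x where x: "x \<in> D" "\<And>i. i \<in> I \<Longrightarrow> x \<in> C i" by blast
  have "f x = L f" if f: "f \<in> cdual" for f
  proof -
    have "\<bar>f x - L f\<bar> \<le> 0 + e" if "e > 0" for e
      using x(2)[of "(f, e)"] f that by (simp add: I_def C_def)
    then have "\<bar>f x - L f\<bar> \<le> 0" by (rule field_le_epsilon)
    then show ?thesis by simp
  qed
  then show thesis using that x(1) by blast
qed


section \<open>The Radon measure of a mean\<close>

text \<open>In a Hausdorff space the disjoint compact sets \<open>C - U\<close> and \<open>C - W\<close> have disjoint open neighbourhoods,
and removing these from \<open>C\<close> leaves the two parts.\<close>

lemma compact_subset_Un_open:
  fixes C :: "'a::t2_space set"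
  assumes C: "compact C" "C \<subseteq> U \<union> W" and open_UW: "open U" "open W"
  obtains C1 C2 where "compact C1" "compact C2" "C = C1 \<union> C2" "C1 \<subseteq> U" "C2 \<subseteq> W"
proof -
  have "compactin euclidean (C - U)" "compactin euclidean (C - W)"
    using C(1) open_UW by (simp_all add: compact_diff)
  moreover have "disjnt (C - U) (C - W)" using C(2) by (auto simp: disjnt_def)
  moreover have "Hausdorff_space (euclidean :: 'a topology)"
    using hausdorff by (fastforce simp: Hausdorff_space_def disjnt_def)
  ultimately obtain A B where AB: "open A" "open B" "C - U \<subseteq> A" "C - W \<subseteq> B" "disjnt A B"
    using Hausdorff_space_compact_separation[of euclidean "C - U" "C - W"] by (auto simp del: compactin_euclidean_iff)
  show thesis
  proof
    show "compact (C - A)" "compact (C - B)" using C(1) AB by (simp_all add: compact_diff)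
    show "C = (C - A) \<union> (C - B)" using AB(5) by (auto simp: disjnt_def)
    show "C - A \<subseteq> U" "C - B \<subseteq> W" using AB(3,4) by auto
  qed
qed

context
  fixes K :: "'a::t2_space set" and L
  assumes L: "mean K L" and K: "compact K"
begin

text \<open>A mean is only finitely additive.  The countably additive measure with the same integrals of continuous
functions arises from its values on compact sets: these are extended to open sets from inside and then
to all sets from outside.\<close>

definition mean_content :: "'a set \<Rightarrow> ennreal" where
  "mean_content C = ennreal (L (indicator C))"

definition inner_content :: "'a set \<Rightarrow> ennreal" where
  "inner_content U = (SUP C\<in>{C. compact C \<and> C \<subseteq> U \<inter> K}. mean_content C)"

definition mean_outer :: "'a set \<Rightarrow> ennreal" where
  "mean_outer A = (INF U\<in>{U. open U \<and> A \<subseteq> U}. inner_content U)"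

lemma mean_indicator_nonneg: "A \<in> sets borel \<Longrightarrow> 0 \<le> L (indicator A)"
  by (intro mean_ge[OF L] bdd_borel_indicator) auto

lemma content_mono:
  assumes "A \<in> sets borel" "B \<in> sets borel" "A \<inter> K \<subseteq> B"
  shows "mean_content A \<le> mean_content B"
  unfolding mean_content_def using assms
  by (intro ennreal_leI mean_mono[OF L] bdd_borel_indicator) (auto simp: indicator_def)

lemma content_Un_le:
  assumes "A \<in> sets borel" "B \<in> sets borel"
  shows "mean_content (A \<union> B) \<le> mean_content A + mean_content B"
proof -
  have "L (indicator (A \<union> B)) \<le> L (\<lambda>x. indicator A x + indicator B x)"
    using assms by (intro mean_mono[OF L] bdd_borel_indicator bdd_borel_add) (auto simp: indicator_def)
  also have "\<dots> = L (indicator A) + L (indicator B)"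
    using assms by (intro mean_add[OF L] bdd_borel_indicator)
  finally show ?thesis
    using assms by (simp add: mean_content_def ennreal_plus[symmetric] mean_indicator_nonneg ennreal_leI del: ennreal_plus)
qed

lemma content_Un_disjoint:
  assumes "A \<in> sets borel" "B \<in> sets borel" "A \<inter> B = {}"
  shows "mean_content (A \<union> B) = mean_content A + mean_content B"
proof -
  have "(indicator (A \<union> B) :: 'a \<Rightarrow> real) = (\<lambda>x. indicator A x + indicator B x)"
    using assms(3) by (auto simp: indicator_def fun_eq_iff)
  then have "L (indicator (A \<union> B)) = L (indicator A) + L (indicator B)"
    using assms by (simp add: mean_add[OF L] bdd_borel_indicator)
  then show ?thesis
    using assms by (simp add: mean_content_def mean_indicator_nonneg)
qed

lemma content_le_1: "A \<in> sets borel \<Longrightarrow> mean_content A \<le> 1"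
  unfolding mean_content_def using mean_le[OF L bdd_borel_indicator, of A 1]
  by (simp add: indicator_def)

lemma content_K: "mean_content K = 1"
proof -
  have "1 \<le> L (indicator K)"
    using borel_compact[OF K] by (intro mean_ge[OF L] bdd_borel_indicator) auto
  then show ?thesis
    using content_le_1[OF borel_compact[OF K]] by (intro antisym) (simp_all add: mean_content_def)
qed

lemma content_empty: "mean_content {} = 0"
proof -
  have "indicator {} = (\<lambda>x::'a. 0::real)" by auto
  then show ?thesis by (simp add: mean_content_def mean_const[OF L])
qed

lemma content_le_inner_content: "compact C \<Longrightarrow> C \<subseteq> U \<inter> K \<Longrightarrow> mean_content C \<le> inner_content U"
  unfolding inner_content_def by (intro SUP_upper) auto

lemma inner_content_le: "open U \<Longrightarrow> inner_content U \<le> mean_content U"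
  unfolding inner_content_def by (intro SUP_least content_mono) (auto intro: borel_compact)

lemma inner_content_mono: "U \<subseteq> W \<Longrightarrow> inner_content U \<le> inner_content W"
  unfolding inner_content_def by (intro SUP_subset_mono) auto

text \<open>Compactness reduces countable subadditivity on open sets to finitely many of them, and there a compact
set can be distributed over the open sets that cover it.\<close>

lemma content_le_sum_inner_content:
  assumes "compact C" "C \<subseteq> K" "C \<subseteq> (\<Union>i<n. U i)" "\<And>i. open (U i)"
  shows "mean_content C \<le> (\<Sum>i<n::nat. inner_content (U i))"
  using assms(1-3)
proof (induction n arbitrary: C)
  case 0
  then show ?case by (simp add: content_empty)
next
  case (Suc n)
  have "C \<subseteq> (\<Union>i<n. U i) \<union> U n" using Suc.prems(3) by (auto simp: lessThan_Suc)
  then obtain C1 C2 where C: "compact C1" "compact C2" "C = C1 \<union> C2" "C1 \<subseteq> (\<Union>i<n. U i)" "C2 \<subseteq> U n"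
    by (rule compact_subset_Un_open[OF Suc.prems(1)]) (use assms(4) in blast)+
  have "mean_content C \<le> mean_content C1 + mean_content C2"
    unfolding C(3) using C by (intro content_Un_le borel_compact)
  also have "mean_content C1 \<le> (\<Sum>i<n. inner_content (U i))" using C Suc.prems(2) by (intro Suc.IH) auto
  also have "mean_content C2 \<le> inner_content (U n)"
    using C Suc.prems(2) by (intro content_le_inner_content) auto
  finally show ?case by (simp add: add_mono)
qed

lemma inner_content_UN_le:
  assumes "\<And>i::nat. open (U i)"
  shows "inner_content (\<Union>i. U i) \<le> (\<Sum>i. inner_content (U i))"
  unfolding inner_content_def[of "\<Union>i. U i"]
proof (rule SUP_least)
  fix C assume "C \<in> {C. compact C \<and> C \<subseteq> (\<Union>i. U i) \<inter> K}"
  then have C: "compact C" "C \<subseteq> (\<Union>i. U i)" "C \<subseteq> K" by auto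
  obtain I where I: "finite I" "C \<subseteq> (\<Union>i\<in>I. U i)"
    by (rule compactE_image[OF C(1) assms C(2)]) blast
  obtain n where n: "I \<subseteq> {..<n}" using finite_nat_bounded[OF I(1)] by blast
  have "C \<subseteq> (\<Union>i<n. U i)" using I(2) n by blast
  then have "mean_content C \<le> (\<Sum>i<n. inner_content (U i))"
    by (rule content_le_sum_inner_content[OF C(1,3) _ assms])
  also have "\<dots> \<le> (\<Sum>i. inner_content (U i))" by (rule sum_le_suminf) auto
  finally show "mean_content C \<le> (\<Sum>i. inner_content (U i))" .
qed

lemma mean_outer_open: "open U \<Longrightarrow> mean_outer U = inner_content U"
  unfolding mean_outer_def
  by (intro antisym INF_lower INF_greatest) (auto intro: inner_content_mono)

lemma mean_outer_le: "open U \<Longrightarrow> A \<subseteq> U \<Longrightarrow> mean_outer A \<le> inner_content U"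
  unfolding mean_outer_def by (intro INF_lower) auto

lemma outer_measure_space_mean_outer: "outer_measure_space (Pow UNIV) mean_outer"
  unfolding outer_measure_space_def
proof (intro conjI)
  have "inner_content {} \<le> 0"
    using inner_content_le[of "{}"] by (simp add: content_empty)
  then show "positive (Pow UNIV) mean_outer"
    by (simp add: positive_def mean_outer_open)
  show "increasing (Pow UNIV) mean_outer"
    unfolding increasing_def mean_outer_def by (auto intro!: INF_superset_mono)
  show "countably_subadditive (Pow UNIV) mean_outer"
    unfolding countably_subadditive_def
  proof (intro allI impI)
    fix A :: "nat \<Rightarrow> 'a set"
    show "mean_outer (\<Union>i. A i) \<le> (\<Sum>n. mean_outer (A n))"
    proof (rule ennreal_le_epsilon)
      fix e :: real assume e: "0 < e" "(\<Sum>n. mean_outer (A n)) < top"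
      then have *: "mean_outer (A n) < mean_outer (A n) + e * (1/2)^Suc n" for n
        by (auto simp add: less_top dest!: ennreal_suminf_lessD)
      have "\<exists>U. open U \<and> A n \<subseteq> U \<and> inner_content U \<le> mean_outer (A n) + e * (1/2)^Suc n" for n
        using *[of n] unfolding mean_outer_def[of "A n"] INF_less_iff by (auto intro: less_imp_le)
      then obtain U where U: "\<And>n. open (U n)" "\<And>n. A n \<subseteq> U n"
          "\<And>n. inner_content (U n) \<le> mean_outer (A n) + e * (1/2)^Suc n"
        by metis
      have "mean_outer (\<Union>i. A i) \<le> inner_content (\<Union>i. U i)"
        using U(1,2) by (intro mean_outer_le) auto
      also have "\<dots> \<le> (\<Sum>i. inner_content (U i))" by (rule inner_content_UN_le[OF U(1)])
      also have "\<dots> \<le> (\<Sum>n. mean_outer (A n) + e * (1/2) ^ Suc n)"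
        by (intro suminf_le U(3)) auto
      also have "\<dots> = (\<Sum>n. mean_outer (A n)) + (\<Sum>n. ennreal e * ennreal ((1/2) ^ Suc n))"
        using e(1) by (subst suminf_add[symmetric])
          (auto simp del: ennreal_suminf_cmult simp add: ennreal_mult[symmetric])
      also have "\<dots> = (\<Sum>n. mean_outer (A n)) + e"
        unfolding ennreal_suminf_cmult
        by (subst suminf_ennreal_eq[OF zero_le_power power_half_series]) auto
      finally show "mean_outer (\<Union>i. A i) \<le> (\<Sum>n. mean_outer (A n)) + e" .
    qed
  qed
qed

text \<open>Caratheodory's condition for an open \<open>U\<close>.  A compact \<open>C \<subseteq> W \<inter> U\<close> is chosen first; then the set \<open>W - C\<close>
is still open and contains \<open>A - U\<close>, and compact subsets of it are disjoint from \<open>C\<close>, where the mean is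
additive.\<close>

lemma open_mean_outer_additive:
  assumes U: "open U"
  shows "mean_outer (A \<inter> U) + mean_outer (A - U) \<le> mean_outer A"
  unfolding mean_outer_def[of A]
proof (rule INF_greatest)
  fix W assume "W \<in> {W. open W \<and> A \<subseteq> W}"
  then have W: "open W" "A \<subseteq> W" by auto
  have ne: "{C. compact C \<and> C \<subseteq> V \<inter> K} \<noteq> {}" for V by (auto intro!: exI[of _ "{}"])
  have "mean_content C + mean_outer (A - U) \<le> inner_content W" if C: "compact C" "C \<subseteq> (W \<inter> U) \<inter> K" for C
  proof -
    have "A - U \<subseteq> W - C" using W(2) C(2) by auto
    moreover have "open (W - C)" using W(1) C(1) by (simp add: open_Diff compact_imp_closed)
    ultimately have "mean_content C + mean_outer (A - U) \<le> mean_content C + inner_content (W - C)"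
      by (intro add_left_mono mean_outer_le)
    also have "\<dots> = (SUP C'\<in>{C'. compact C' \<and> C' \<subseteq> (W - C) \<inter> K}. mean_content C + mean_content C')"
      unfolding inner_content_def by (rule ennreal_SUP_add_right[OF ne])
    also have "\<dots> \<le> inner_content W"
    proof (rule SUP_least)
      fix C' assume "C' \<in> {C'. compact C' \<and> C' \<subseteq> (W - C) \<inter> K}"
      then have C': "compact C'" "C' \<subseteq> (W - C) \<inter> K" by auto
      have "mean_content C + mean_content C' = mean_content (C \<union> C')"
        using C C' by (intro content_Un_disjoint[symmetric] borel_compact) auto
      also have "\<dots> \<le> inner_content W"
        using C C' by (intro content_le_inner_content compact_Un) auto
      finally show "mean_content C + mean_content C' \<le> inner_content W" .
    qed
    finally show ?thesis .
  qed
  then have "inner_content (W \<inter> U) + mean_outer (A - U) \<le> inner_content W"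
    unfolding inner_content_def[of "W \<inter> U"] ennreal_SUP_add_left[OF ne, symmetric]
    by (intro SUP_least) auto
  moreover have "mean_outer (A \<inter> U) \<le> inner_content (W \<inter> U)"
    using U W by (intro mean_outer_le) auto
  ultimately show "mean_outer (A \<inter> U) + mean_outer (A - U) \<le> inner_content W"
    by (meson add_right_mono order_trans)
qed

definition mean_measure :: "'a measure" where
  "mean_measure = measure_of UNIV (sets borel) mean_outer"

lemma sets_mean_measure [simp, measurable_cong]: "sets mean_measure = sets borel"
  by (simp add: mean_measure_def sets.sigma_sets_eq[of borel, simplified])

lemma space_mean_measure [simp]: "space mean_measure = UNIV"
  by (simp add: mean_measure_def)

lemma emeasure_mean_measure:
  assumes B: "B \<in> sets borel"
  shows "emeasure mean_measure B = mean_outer B"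
proof -
  interpret P: sigma_algebra UNIV "Pow UNIV :: 'a set set" by (rule sigma_algebra_Pow)
  let ?L = "lambda_system UNIV (Pow UNIV) mean_outer"
  note ms = P.caratheodory_lemma[OF outer_measure_space_mean_outer]
  have "U \<in> ?L" if U: "open U" for U
    unfolding P.lambda_system_eq
  proof (intro CollectI conjI ballI)
    fix A :: "'a set"
    have "subadditive (Pow UNIV) mean_outer"
      using outer_measure_space_mean_outer unfolding outer_measure_space_def
      by (blast intro: P.countably_subadditive_subadditive)
    then have "mean_outer ((A \<inter> U) \<union> (A - U)) \<le> mean_outer (A \<inter> U) + mean_outer (A - U)"
      by (rule subadditiveD) auto
    then have "mean_outer A \<le> mean_outer (A \<inter> U) + mean_outer (A - U)" by (simp add: Int_Diff_Un)
    then show "mean_outer (A \<inter> U) + mean_outer (A - U) = mean_outer A"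
      using open_mean_outer_additive[OF U] by (rule antisym[rotated])
  qed simp
  then have "sigma_sets UNIV {S. open S} \<subseteq> ?L"
    using ms by (intro sigma_algebra.sigma_sets_subset) (auto simp: measure_space_def)
  then have "sets borel \<subseteq> ?L" by (simp add: borel_def)
  then have "measure_space UNIV (sets borel) mean_outer"
    using sets.sigma_algebra_axioms[of "borel :: 'a measure"] by (intro measure_down[OF ms]) auto
  then show ?thesis
    using B sets.sigma_sets_eq[of "borel :: 'a measure"]
    unfolding mean_measure_def measure_space_def
    by (subst emeasure_measure_of_sigma) auto
qed

lemma mean_measure_UNIV: "emeasure mean_measure UNIV = 1"
proof (rule antisym)
  show "emeasure mean_measure UNIV \<le> 1"
    using inner_content_le[of UNIV] content_le_1[of UNIV]
    by (simp add: emeasure_mean_measure mean_outer_open)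
  show "1 \<le> emeasure mean_measure UNIV"
    using content_le_inner_content[OF K, of UNIV]
    by (simp add: emeasure_mean_measure mean_outer_open content_K)
qed

lemma prob_space_mean_measure: "prob_space mean_measure"
  by (rule prob_spaceI) (simp add: mean_measure_UNIV)

lemma mean_measure_K: "emeasure mean_measure K = 1"
proof (rule antisym)
  show "emeasure mean_measure K \<le> 1"
    by (metis emeasure_space mean_measure_UNIV space_mean_measure)
  show "1 \<le> emeasure mean_measure K"
    unfolding emeasure_mean_measure[OF borel_compact[OF K]] mean_outer_def
    using content_le_inner_content[OF K] by (intro INF_greatest) (auto simp: content_K)
qed

lemma AE_mean_measure_K: "AE x in mean_measure. x \<in> K"
proof -
  interpret prob_space mean_measure by (rule prob_space_mean_measure)
  show ?thesis
    using mean_measure_K borel_compact[OF K] prob_eq_1[of K] by (simp add: emeasure_eq_measure)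
qed

lemma mean_measure_Int_K:
  assumes "B \<in> sets borel" shows "emeasure mean_measure (B \<inter> K) = emeasure mean_measure B"
  using AE_mean_measure_K assms borel_compact[OF K] by (intro emeasure_eq_AE) auto

text \<open>The outer measure is regular from outside by construction; complements in \<open>K\<close> turn this into
regularity from inside.\<close>

lemma mean_measure_inner_regular:
  assumes B: "B \<in> sets borel"
  shows "emeasure mean_measure B = (SUP C\<in>{C. compact C \<and> C \<subseteq> B \<inter> K}. emeasure mean_measure C)"
proof (rule antisym)
  interpret prob_space mean_measure by (rule prob_space_mean_measure)
  show "(SUP C\<in>{C. compact C \<and> C \<subseteq> B \<inter> K}. emeasure mean_measure C) \<le> emeasure mean_measure B"
    using B by (intro SUP_least emeasure_mono) auto
  show "emeasure mean_measure B \<le> (SUP C\<in>{C. compact C \<and> C \<subseteq> B \<inter> K}. emeasure mean_measure C)"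
  proof (rule ennreal_le_epsilon)
    fix e :: real assume e: "0 < e"
    have "mean_outer (- B) < mean_outer (- B) + e"
      using B e emeasure_finite[of "- B"] by (simp add: emeasure_mean_measure less_top)
    then obtain W where W: "open W" "- B \<subseteq> W" "inner_content W < mean_outer (- B) + e"
      unfolding mean_outer_def[of "- B"] INF_less_iff by auto
    have C: "compact (K - W)" "K - W \<subseteq> B \<inter> K" using K W by (auto simp: compact_diff)
    have "emeasure mean_measure W < emeasure mean_measure (- B) + e"
      using W B by (simp add: emeasure_mean_measure mean_outer_open)
    then have "measure mean_measure W < measure mean_measure (- B) + e"
      using e by (simp add: emeasure_eq_measure ennreal_plus[symmetric] ennreal_less_iff del: ennreal_plus)
    also have "measure mean_measure (- B) = 1 - measure mean_measure B"
      using prob_compl[of B] B by (simp add: Compl_eq_Diff_UNIV)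
    finally have "measure mean_measure B < (1 - measure mean_measure W) + e" by simp
    also have "1 - measure mean_measure W = measure mean_measure (- W)"
      using prob_compl[of W] W(1) by (simp add: Compl_eq_Diff_UNIV)
    also have "\<dots> = measure mean_measure (- W \<inter> K)"
      using mean_measure_Int_K[of "- W"] W(1) by (simp add: measure_def)
    also have "- W \<inter> K = K - W" by auto
    finally have "emeasure mean_measure B \<le> emeasure mean_measure (K - W) + e"
      using e by (simp add: emeasure_eq_measure ennreal_plus[symmetric] ennreal_leI del: ennreal_plus)
    also have "emeasure mean_measure (K - W) \<le> (SUP C\<in>{C. compact C \<and> C \<subseteq> B \<inter> K}. emeasure mean_measure C)"
      using C by (intro SUP_upper) auto
    finally show "emeasure mean_measure B
        \<le> (SUP C\<in>{C. compact C \<and> C \<subseteq> B \<inter> K}. emeasure mean_measure C) + e"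
      by (simp add: add_right_mono)
  qed
qed

lemma integrable_mean_measure:
  assumes "g \<in> bdd_borel K" shows "integrable mean_measure g"
proof -
  interpret prob_space mean_measure by (rule prob_space_mean_measure)
  obtain M where M: "\<And>x. x \<in> K \<Longrightarrow> \<bar>g x\<bar> \<le> M"
    using assms unfolding bdd_borel_def bounded_iff by auto
  have "AE x in mean_measure. norm (g x) \<le> M"
    using AE_mean_measure_K by eventually_elim (simp add: M)
  moreover have "g \<in> borel_measurable mean_measure"
    using assms by (simp add: bdd_borel_def cong: measurable_cong_sets)
  ultimately show ?thesis by (rule integrable_const_bound)
qed

text \<open>The measure of an open set is at most the mean of its indicator.  A continuous function with values in
\<open>[0, 1]\<close> is within \<open>1/n\<close> of an average of the indicators of its \<open>n\<close> open superlevel sets, so the inequality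
passes to it.\<close>

lemma integral_mean_measure_le_unit_interval:
  assumes g: "continuous_on UNIV g" and g01: "\<And>x. x \<in> K \<Longrightarrow> 0 \<le> g x \<and> g x \<le> 1"
  shows "(\<integral>x. g x \<partial>mean_measure) \<le> L g"
proof (rule field_le_epsilon)
  interpret prob_space mean_measure by (rule prob_space_mean_measure)
  have gB: "g \<in> bdd_borel K" using K g by (rule bdd_borel_continuous)
  fix e :: real assume "0 < e"
  then obtain m where m: "inverse (real (Suc m)) < e" using reals_Archimedean by blast
  define n where "n = Suc m"
  have n: "0 < n" "inverse (real n) < e" using m by (simp_all add: n_def)
  \<comment> \<open>On \<open>K\<close> the function \<open>h\<close> is \<open>g\<close> rounded up to a multiple of \<open>1/n\<close>.\<close>
  define U where "U k = {x. real k < real n * g x}" for k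
  define h where "h x = (\<Sum>k<n. inverse (real n) * indicator (U k) x)" for x
  have U: "open (U k)" for k
    unfolding U_def using g by (intro open_Collect_less continuous_intros)
  have hB: "h \<in> bdd_borel K"
    unfolding h_def using U by (intro bdd_borel_sum bdd_borel_cmult bdd_borel_indicator) auto
  have h: "g x \<le> h x \<and> h x \<le> g x + inverse (real n)" if "x \<in> K" for x
  proof -
    define c where "c = nat \<lceil>real n * g x\<rceil>"
    have y: "0 \<le> real n * g x" "real n * g x \<le> real n"
      using g01[OF that] mult_left_mono[of "g x" 1 "real n"] by simp_all
    have c: "c \<le> n" using y(2) unfolding c_def by linarith
    have iff: "real k < real n * g x \<longleftrightarrow> k < c" for k
    proof -
      have "k < c \<longleftrightarrow> int k < \<lceil>real n * g x\<rceil>" unfolding c_def by linarith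
      also have "\<dots> \<longleftrightarrow> real k < real n * g x" unfolding less_ceiling_iff by simp
      finally show ?thesis ..
    qed
    have "{..<n} \<inter> {k. x \<in> U k} = {..<c}"
      unfolding U_def mem_Collect_eq iff using c by auto
    then have "(\<Sum>k<n. indicator (U k) x) = real c"
      by (simp add: indicator_def sum.If_cases)
    then have hx: "h x = inverse (real n) * real c"
      by (simp add: h_def sum_distrib_left[symmetric])
    have "real n * g x \<le> real c" "real c \<le> real n * g x + 1"
      using y(1) unfolding c_def by linarith+
    then show ?thesis using n(1) by (simp add: hx field_simps)
  qed
  have "(\<integral>x. g x \<partial>mean_measure) \<le> (\<integral>x. h x \<partial>mean_measure)"
  proof (rule integral_mono_AE)
    show "AE x in mean_measure. g x \<le> h x"
      using AE_mean_measure_K by eventually_elim (simp add: h)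
  qed (intro integrable_mean_measure gB hB)+
  also have "\<dots> = (\<Sum>k<n. inverse (real n) * measure mean_measure (U k))"
    unfolding h_def using U by (subst Bochner_Integration.integral_sum) (auto simp: emeasure_eq_measure)
  also have "\<dots> \<le> (\<Sum>k<n. inverse (real n) * L (indicator (U k)))"
  proof (intro sum_mono mult_left_mono)
    fix k
    have "emeasure mean_measure (U k) \<le> ennreal (L (indicator (U k)))"
      using inner_content_le[OF U, of k] U by (simp add: emeasure_mean_measure mean_outer_open mean_content_def)
    then show "measure mean_measure (U k) \<le> L (indicator (U k))"
      using U mean_indicator_nonneg[of "U k"] by (simp add: emeasure_eq_measure)
  qed simp
  also have "\<dots> = L h"
    unfolding h_def using bdd_borel_indicator[of "U k" K for k] U
    by (subst mean_sum[OF L]) (auto simp: mean_cmult[OF L] intro: bdd_borel_cmult)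
  also have "\<dots> \<le> L (\<lambda>x. g x + inverse (real n))"
    using h by (intro mean_mono[OF L] hB bdd_borel_add gB bdd_borel_const) auto
  also have "\<dots> = L g + inverse (real n)"
    by (simp add: mean_add[OF L gB bdd_borel_const] mean_const[OF L])
  finally show "(\<integral>x. g x \<partial>mean_measure) \<le> L g + e" using n(2) by simp
qed

text \<open>Applying the inequality to \<open>g\<close> and to \<open>- g\<close>, each rescaled into \<open>[0, 1]\<close>, gives equality.\<close>

lemma integral_mean_measure:
  assumes g: "continuous_on UNIV g"
  shows "(\<integral>x. g x \<partial>mean_measure) = L g"
proof -
  interpret prob_space mean_measure by (rule prob_space_mean_measure)
  have le: "(\<integral>x. g x \<partial>mean_measure) \<le> L g" if g: "continuous_on UNIV g" for g
  proof -
    have gB: "g \<in> bdd_borel K" using K g by (rule bdd_borel_continuous)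
    obtain M where M: "0 < M" "\<And>x. x \<in> K \<Longrightarrow> \<bar>g x\<bar> \<le> M"
      using gB unfolding bdd_borel_def bounded_pos by auto
    define c where "c = inverse (2 * M)"
    have c: "0 < c" "c * M = 1/2" using M(1) by (simp_all add: c_def)
    have "0 \<le> c * g x + 1/2 \<and> c * g x + 1/2 \<le> 1" if "x \<in> K" for x
    proof -
      have "\<bar>c * g x\<bar> \<le> 1/2"
        using mult_left_mono[OF M(2)[OF that], of c] c by (simp add: abs_mult)
      then show ?thesis by linarith
    qed
    then have "(\<integral>x. c * g x + 1/2 \<partial>mean_measure) \<le> L (\<lambda>x. c * g x + 1/2)"
      by (intro integral_mean_measure_le_unit_interval continuous_intros g)
    also have "(\<integral>x. c * g x + 1/2 \<partial>mean_measure) = c * (\<integral>x. g x \<partial>mean_measure) + 1/2"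
      using integrable_mean_measure[OF gB] prob_space by simp
    also have "L (\<lambda>x. c * g x + 1/2) = c * L g + 1/2"
      by (simp add: mean_add[OF L] mean_cmult[OF L] mean_const[OF L] bdd_borel_cmult gB bdd_borel_const)
    finally show ?thesis using c(1) by simp
  qed
  have "(\<integral>x. - 1 * g x \<partial>mean_measure) \<le> L (\<lambda>x. - 1 * g x)"
    by (intro le continuous_intros g)
  also have "\<dots> = - 1 * L g" by (rule mean_cmult[OF L bdd_borel_continuous[OF K g]])
  finally show ?thesis using le[OF g] by simp
qed

text \<open>The set \<open>X\<close> need not be Borel, so the measure is first restricted to \<open>K\<close> and then pushed forward to \<open>X\<close>.\<close>

theorem mean_representing_radon_prob:
  assumes KX: "K \<subseteq> X"
  obtains \<mu> where "\<mu> \<in> radon_prob X" "\<And>g. continuous_on UNIV g \<Longrightarrow> (\<integral>x. g x \<partial>\<mu>) = L g"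
proof -
  interpret N: prob_space mean_measure by (rule prob_space_mean_measure)
  define R where "R = restrict_space mean_measure K"
  define \<mu> where "\<mu> = distr R (restrict_space borel X) (\<lambda>x. x)"
  have Ks: "K \<in> sets borel" using K by (rule borel_compact)
  have meas: "(\<lambda>x. x) \<in> measurable R (restrict_space borel X)"
    unfolding R_def using KX by (intro measurable_restrict_space3) auto
  have sets: "sets \<mu> = sets (restrict_space borel X)" and space: "space \<mu> = X"
    by (simp_all add: \<mu>_def space_restrict_space)
  have em: "emeasure \<mu> (B \<inter> X) = emeasure mean_measure (B \<inter> K)" if B: "B \<in> sets borel" for B
  proof -
    have "B \<inter> X \<in> sets (restrict_space borel X)"
      using B by (auto simp: sets_restrict_space)
    then have "emeasure \<mu> (B \<inter> X) = emeasure R (B \<inter> X \<inter> K)"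
      unfolding \<mu>_def by (subst emeasure_distr[OF meas]) (auto simp: R_def space_restrict_space)
    also have "B \<inter> X \<inter> K = B \<inter> K" using KX by auto
    also have "emeasure R (B \<inter> K) = emeasure mean_measure (B \<inter> K)"
      unfolding R_def using Ks by (intro emeasure_restrict_space) auto
    finally show ?thesis .
  qed
  have "prob_space \<mu>"
    using em[of UNIV] by (intro prob_spaceI) (simp add: space mean_measure_K)
  moreover have "emeasure \<mu> B = (SUP C\<in>{C. compact C \<and> C \<subseteq> B}. emeasure \<mu> C)"
    if B: "B \<in> sets \<mu>" for B
  proof (rule antisym)
    obtain B' where B': "B' \<in> sets borel" "B = B' \<inter> X"
      using B unfolding sets by (auto simp: sets_restrict_space)
    have emC: "emeasure \<mu> C = emeasure mean_measure (C \<inter> K)" if "compact C" "C \<subseteq> X" for C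
      using em[OF borel_compact[OF that(1)]] that(2) by (simp add: Int_absorb2)
    show "(SUP C\<in>{C. compact C \<and> C \<subseteq> B}. emeasure \<mu> C) \<le> emeasure \<mu> B"
      using B by (intro SUP_least emeasure_mono) auto
    have "emeasure \<mu> B = emeasure mean_measure B'"
      using em[OF B'(1)] mean_measure_Int_K[OF B'(1)] by (simp add: B'(2))
    also have "\<dots> = (SUP C\<in>{C. compact C \<and> C \<subseteq> B' \<inter> K}. emeasure mean_measure C)"
      by (rule mean_measure_inner_regular[OF B'(1)])
    also have "\<dots> \<le> (SUP C\<in>{C. compact C \<and> C \<subseteq> B}. emeasure \<mu> C)"
    proof (rule SUP_mono)
      fix C assume "C \<in> {C. compact C \<and> C \<subseteq> B' \<inter> K}"
      then have C: "compact C" "C \<subseteq> B'" "C \<subseteq> K" by auto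
      then have "emeasure mean_measure C = emeasure \<mu> C"
        using KX by (subst emC) (auto simp: Int_absorb2)
      then show "\<exists>C'\<in>{C. compact C \<and> C \<subseteq> B}. emeasure mean_measure C \<le> emeasure \<mu> C'"
        using C KX B'(2) by (intro bexI[of _ C]) auto
    qed
    finally show "emeasure \<mu> B \<le> (SUP C\<in>{C. compact C \<and> C \<subseteq> B}. emeasure \<mu> C)" .
  qed
  ultimately have "\<mu> \<in> radon_prob X" using sets space by (simp add: radon_prob_def)
  moreover have "(\<integral>x. g x \<partial>\<mu>) = L g" if g: "continuous_on UNIV g" for g
  proof -
    have gm: "g \<in> borel_measurable borel" using g by (rule borel_measurable_continuous_onI)
    have "(\<integral>x. g x \<partial>\<mu>) = (\<integral>x. g x \<partial>R)"
      unfolding \<mu>_def by (intro integral_distr meas measurable_restrict_space1 gm)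
    also have "\<dots> = (\<integral>x. indicator K x *\<^sub>R g x \<partial>mean_measure)"
      unfolding R_def using Ks by (intro integral_restrict_space) auto
    also have "\<dots> = (\<integral>x. g x \<partial>mean_measure)"
    proof (rule integral_cong_AE)
      show "AE x in mean_measure. indicator K x *\<^sub>R g x = g x"
        using AE_mean_measure_K by eventually_elim simp
    qed (use gm Ks in \<open>auto cong: measurable_cong_sets\<close>)
    also have "\<dots> = L g" by (rule integral_mean_measure[OF g])
    finally show ?thesis .
  qed
  ultimately show thesis by (rule that)
qed

end


section \<open>Barycentric sets are compactly convex\<close>

text \<open>The value 0 outside \<open>bdd_borel K\<close> keeps the set inside a product of compact intervals.\<close>

definition means :: "'a::topological_space set \<Rightarrow> (('a \<Rightarrow> real) \<Rightarrow> real) set" where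
  "means K = {L. mean K L \<and> (\<forall>g. g \<notin> bdd_borel K \<longrightarrow> L g = 0)}"

lemma means_restrict:
  assumes "mean K L"
  shows "(\<lambda>g. if g \<in> bdd_borel K then L g else 0) \<in> means K"
  using assms unfolding means_def mean_def by (simp add: bdd_borel_add bdd_borel_cmult)

lemma compact_means: "compact (means K)"
proof -
  define R where "R g = (SOME M. \<forall>x\<in>K. \<bar>g x\<bar> \<le> M)" for g :: "'a \<Rightarrow> real"
  have R: "\<bar>g x\<bar> \<le> R g" if g: "g \<in> bdd_borel K" and x: "x \<in> K" for g x
  proof -
    have "\<exists>M. \<forall>x\<in>K. \<bar>g x\<bar> \<le> M" using g unfolding bdd_borel_def bounded_iff by auto
    then have "\<forall>x\<in>K. \<bar>g x\<bar> \<le> R g" unfolding R_def by (rule someI_ex)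
    then show ?thesis using x by blast
  qed
  define B where "B g = (if g \<in> bdd_borel K then {- R g..R g} else {0})" for g
  have "compactin (product_topology (\<lambda>_. euclidean) UNIV) (PiE UNIV B)"
    by (subst compactin_PiE) (auto simp: B_def)
  then have compact: "compact (PiE UNIV B)" by (simp add: euclidean_product_topology)
  have "closed (means K)"
    unfolding means_def mean_def Ball_def
    by (intro closed_Collect_conj closed_Collect_all closed_Collect_imp open_Collect_const
        closed_Collect_eq closed_Collect_le continuous_intros continuous_on_product_coordinates)
  moreover have "means K \<subseteq> PiE UNIV B"
  proof
    fix L assume "L \<in> means K"
    then have L: "mean K L" and 0: "\<And>g. g \<notin> bdd_borel K \<Longrightarrow> L g = 0" by (auto simp: means_def)
    have "L g \<in> B g" for g
    proof (cases "g \<in> bdd_borel K")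
      case True
      have "L g \<le> R g" using R[OF True] by (intro mean_le[OF L True]) (auto simp: abs_le_iff)
      moreover have "- R g \<le> L g" using R[OF True] by (intro mean_ge[OF L True]) (force simp: abs_le_iff)
      ultimately show ?thesis using True by (simp add: B_def)
    next
      case False
      then show ?thesis by (simp add: B_def 0)
    qed
    then show "L \<in> PiE UNIV B" by auto
  qed
  ultimately show ?thesis using compact_Int_closed[OF compact, of "means K"] by (simp add: Int_absorb1)
qed

lemma continuous_on_riemann_sum:
  fixes F :: "'a::locally_convex_space set"
  shows "continuous_on S (\<lambda>L. riemann_sum L F r)"
  unfolding riemann_sum_def
  by (intro continuous_on_sum continuous_on_scaleR_lcs continuous_on_const
      continuous_on_subset[OF continuous_on_product_coordinates]) auto

lemma open_scaleR_vimage: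
  fixes V :: "'a::locally_convex_space set"
  shows "open V \<Longrightarrow> open ((\<lambda>v. c *\<^sub>R v) -` V)"
  by (intro open_vimage continuous_on_scaleR_lcs continuous_on_const continuous_on_id)

lemma convex_scaleR_vimage: "convex V \<Longrightarrow> convex ((\<lambda>v. c *\<^sub>R v) -` V)"
  by (intro convex_linear_vimage linear_scaleR)

text \<open>The approximation holds for an arbitrary convex neighbourhood \<open>V\<close> in the original topology, not just for
finitely many functionals: a functional that separates the difference from \<open>V\<close> is less than \<open>1/2\<close> on \<open>V/2\<close>,
so it cannot reach 1 on the difference.\<close>

lemma barycenter_near_riemann_sum:
  fixes K :: "'a::locally_convex_space set"
  assumes L: "mean K L" and x: "\<And>f. f \<in> cdual \<Longrightarrow> f x = L f" and K: "compact K"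
    and V: "open V" "convex V" "0 \<in> V"
    and r: "tagging K ((\<lambda>v. 2 *\<^sub>R v) -` V) F r"
  shows "x - riemann_sum L F r \<in> V"
proof (rule ccontr)
  assume "x - riemann_sum L F r \<notin> V"
  then obtain f where f: "f \<in> cdual" "\<And>v. v \<in> V \<Longrightarrow> f v < 1" "1 \<le> f (x - riemann_sum L F r)"
    using separation_open_convex[OF V] by blast
  have lin: "linear f" using f(1) by (simp add: cdual_def)
  have "L f \<le> f (riemann_sum L F r) + 1 / 2"
  proof (rule mean_le_riemann_sum[OF L r K f(1)])
    fix v assume "v \<in> (\<lambda>v. 2 *\<^sub>R v) -` V"
    then have "f (2 *\<^sub>R v) < 1" using f(2) by simp
    then show "f v \<le> 1 / 2" by (simp add: linear_scale[OF lin])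
  qed
  then show False using f(3) x[OF f(1)] by (simp add: linear_diff[OF lin])
qed

text \<open>One tagging serves all means, so the barycenter map is a uniform limit of the maps \<open>L \<mapsto> riemann_sum L F r\<close>,
which are continuous for pointwise convergence.\<close>

lemma continuous_on_barycenter:
  fixes K :: "'a::locally_convex_space set"
  assumes K: "compact K" and M: "\<And>L. L \<in> M \<Longrightarrow> mean K L"
    and T: "\<And>L f. L \<in> M \<Longrightarrow> f \<in> cdual \<Longrightarrow> f (T L) = L f"
  shows "continuous_on M T"
  unfolding continuous_on_def
proof (intro ballI topological_tendstoI)
  fix L0 U assume L0: "L0 \<in> M" and U: "open U" "T L0 \<in> U"
  have "open ((\<lambda>v. v + T L0) -` U)" using U(1) by (intro open_vimage continuous_intros)
  then obtain V where V: "open V" "convex V" "0 \<in> V" "V \<subseteq> (\<lambda>v. v + T L0) -` U"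
    using convex_nhds_0[of "(\<lambda>v. v + T L0) -` U"] U(2) by auto
  \<comment> \<open>\<open>T L - T L0\<close> will be a sum of three terms; \<open>W\<close> is chosen so that three times each of them, up to sign,
    lies in the convex set \<open>V\<close>.\<close>
  define W where "W = (\<lambda>v. 3 *\<^sub>R v) -` V \<inter> (\<lambda>v. (-3) *\<^sub>R v) -` V"
  have W: "open W" "convex W" "0 \<in> W"
    unfolding W_def using V(1-3)
    by (auto intro: open_scaleR_vimage convex_scaleR_vimage convex_Int)
  have "open ((\<lambda>v. 2 *\<^sub>R v) -` W)" using W(1) by (rule open_scaleR_vimage)
  then obtain F r where r: "tagging K ((\<lambda>v. 2 *\<^sub>R v) -` W) F r"
    using tagging_exists[OF K] W(3) by (metis scaleR_zero_right vimage_eq)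
  define y where "y L = riemann_sum L F r" for L
  have near: "T L - y L \<in> W" if "L \<in> M" for L
    unfolding y_def using M T that by (intro barycenter_near_riemann_sum[OF _ _ K W r]) auto
  have "(y \<longlongrightarrow> y L0) (at L0 within M)"
    using continuous_on_riemann_sum[of M F r] L0 unfolding y_def continuous_on_def by blast
  then have "((\<lambda>L. y L - y L0) \<longlongrightarrow> y L0 - y L0) (at L0 within M)"
    by (intro tendsto_diff tendsto_const)
  then have "\<forall>\<^sub>F L in at L0 within M. y L - y L0 \<in> W"
    using W by (intro topological_tendstoD[of _ "y L0 - y L0"]) auto
  moreover have "\<forall>\<^sub>F L in at L0 within M. L \<in> M" by (simp add: eventually_at_filter)
  ultimately show "\<forall>\<^sub>F L in at L0 within M. T L \<in> U"
  proof eventually_elim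
    case (elim L)
    let ?a = "3 *\<^sub>R (T L - y L)" and ?b = "3 *\<^sub>R (y L - y L0)" and ?c = "(-3) *\<^sub>R (T L0 - y L0)"
    have abc: "?a \<in> V" "?b \<in> V" "?c \<in> V"
      using near[OF elim(2)] near[OF L0] elim(1) by (auto simp: W_def)
    have "(2/3) *\<^sub>R ((1/2) *\<^sub>R ?a + (1/2) *\<^sub>R ?b) + (1/3) *\<^sub>R ?c \<in> V"
      by (intro convexD[OF V(2)] abc) auto
    also have "(2/3) *\<^sub>R ((1/2) *\<^sub>R ?a + (1/2) *\<^sub>R ?b) + (1/3) *\<^sub>R ?c = T L - T L0"
      by (simp add: scaleR_add_right scaleR_diff_right)
    finally show ?case using V(4) by auto
  qed
qed

text \<open>The barycenters of all means on \<open>K\<close> form a compact convex subset of \<open>X\<close>; evaluations at the points of \<open>K\<close>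
are means, so this subset contains \<open>K\<close>.\<close>

theorem barycentric_imp_compactly_convex:
  fixes X :: "'a::locally_convex_space set"
  assumes X: "barycentric X"
  shows "compactly_convex X"
  unfolding compactly_convex_def
proof (intro conjI allI impI)
  show "convex X" using X by (simp add: barycentric_def)
  fix K assume "compact K \<and> K \<subseteq> X"
  then have K: "compact K" "K \<subseteq> X" by auto
  have "\<exists>x. x \<in> X \<and> (\<forall>f\<in>cdual. f x = L f)" if L: "mean K L" for L
  proof -
    obtain \<mu> where \<mu>: "\<mu> \<in> radon_prob X" "\<And>g. continuous_on UNIV g \<Longrightarrow> (\<integral>x. g x \<partial>\<mu>) = L g"
      using mean_representing_radon_prob[OF L K] by blast
    then obtain x where x: "x \<in> X" "barycenter \<mu> = bidual_embedding x"
      using X unfolding barycentric_def by blast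
    have "f x = L f" if "f \<in> cdual" for f
      using fun_cong[OF x(2), of f] \<mu>(2)[of f] that
      by (simp add: barycenter_def bidual_embedding_def cdual_def)
    then show ?thesis using x(1) by blast
  qed
  then obtain T where T: "\<And>L. mean K L \<Longrightarrow> T L \<in> X" "\<And>L f. mean K L \<Longrightarrow> f \<in> cdual \<Longrightarrow> f (T L) = L f"
    by metis
  define T' where "T' = T ` means K"
  have mean: "mean K L" if "L \<in> means K" for L using that by (simp add: means_def)
  have "continuous_on (means K) T"
    using mean T(2) by (intro continuous_on_barycenter[OF K(1)]) auto
  then have "compact T'" unfolding T'_def using compact_means by (rule compact_continuous_image)
  have T'I: "x \<in> T'" if L: "mean K L" and x: "\<And>f. f \<in> cdual \<Longrightarrow> f x = L f" for x L
  proof -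
    let ?L = "\<lambda>g. if g \<in> bdd_borel K then L g else 0"
    have "?L \<in> means K" using L by (rule means_restrict)
    moreover have "x = T ?L"
    proof (rule cdual_separates_points)
      fix f :: "'a \<Rightarrow> real" assume f: "f \<in> cdual"
      then have "f (T ?L) = L f"
        using T(2)[OF mean[OF \<open>?L \<in> means K\<close>] f] bdd_borel_cdual[OF K(1) f] by simp
      then show "f x = f (T ?L)" using x f by simp
    qed
    ultimately show ?thesis unfolding T'_def by blast
  qed
  have "convex T'"
  proof (rule convexI)
    fix x y and u v :: real
    assume "x \<in> T'" "y \<in> T'" and uv: "0 \<le> u" "0 \<le> v" "u + v = 1"
    then obtain L L' where L: "mean K L" "x = T L" "mean K L'" "y = T L'"
      using mean unfolding T'_def by blast
    show "u *\<^sub>R x + v *\<^sub>R y \<in> T'"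
    proof (rule T'I)
      show "mean K (\<lambda>g. u * L g + v * L' g)" using L uv by (intro mean_convex_combination)
      fix f :: "'a \<Rightarrow> real" assume f: "f \<in> cdual"
      then have "linear f" by (simp add: cdual_def)
      then show "f (u *\<^sub>R x + v *\<^sub>R y) = u * L f + v * L' f"
        using T(2)[OF L(1) f] T(2)[OF L(3) f] by (simp add: L linear_add linear_scale)
    qed
  qed
  moreover have "K \<subseteq> T'" using T'I[OF mean_evaluation] by blast
  ultimately have "convex hull K \<subseteq> T'" by (rule hull_minimal[rotated])
  then have "closure (convex hull K) \<subseteq> T'"
    using compact_imp_closed[OF \<open>compact T'\<close>] by (rule closure_minimal)
  moreover have "T' \<subseteq> X" using mean T(1) by (auto simp: T'_def)
  moreover have "convex hull K \<subseteq> X" using \<open>convex X\<close> K(2) by (rule hull_minimal[rotated])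
  ultimately have "top_of_set X closure_of (convex hull K) = T' \<inter> closure (convex hull K)"
    by (auto simp: closure_of_subtopology Int_absorb1)
  then show "compact (top_of_set X closure_of (convex hull K))"
    using \<open>compact T'\<close> by (simp add: compact_Int_closed)
qed


section \<open>Compactly convex sets are barycentric\<close>

lemma star_combination_in_convex:
  assumes S: "convex S" and a: "a \<in> S" and z: "\<And>i. i \<in> I \<Longrightarrow> z i \<in> S"
    and I: "finite I" and c: "\<And>i. i \<in> I \<Longrightarrow> 0 \<le> c i" "sum c I \<le> 1"
  shows "a + (\<Sum>i\<in>I. c i *\<^sub>R (z i - a)) \<in> S"
proof (cases "sum c I = 0")
  case True
  then have "c i = 0" if "i \<in> I" for i using that I c(1) by (simp add: sum_nonneg_eq_0_iff)
  then show ?thesis using a by simp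
next
  case False
  define C where "C = sum c I"
  have C: "0 < C" "C \<le> 1" using False c sum_nonneg[of I c] by (auto simp: C_def)
  have "(\<Sum>i\<in>I. (c i / C) *\<^sub>R z i) \<in> S"
    using C c(1) z by (intro convex_sum[OF I S]) (auto simp: sum_divide_distrib[symmetric] C_def)
  then have "(1 - C) *\<^sub>R a + C *\<^sub>R (\<Sum>i\<in>I. (c i / C) *\<^sub>R z i) \<in> S"
    using C by (intro convexD[OF S a]) auto
  also have "C *\<^sub>R (\<Sum>i\<in>I. (c i / C) *\<^sub>R z i) = (\<Sum>i\<in>I. c i *\<^sub>R z i)"
    using C by (simp add: scaleR_sum_right)
  also have "(1 - C) *\<^sub>R a + (\<Sum>i\<in>I. c i *\<^sub>R z i) = a + (\<Sum>i\<in>I. c i *\<^sub>R (z i - a))"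
    by (simp add: C_def scaleR_diff_right sum_subtractf scaleR_diff_left scaleR_sum_left[symmetric])
  finally show ?thesis .
qed

text \<open>Boundedness in the original topology enters here: it makes the points \<open>z\<^sub>n\<close> below converge.\<close>

lemma lcs_bounded_scaled_tendsto_0:
  fixes X :: "'a::locally_convex_space set"
  assumes X: "lcs_bounded X" "\<And>n. y n \<in> X"
  shows "(\<lambda>n. (1/2::real) ^ n *\<^sub>R y n) \<longlonglongrightarrow> 0"
proof (rule topological_tendstoI)
  fix U :: "'a set" assume "open U" "0 \<in> U"
  then obtain r where r: "r > 0" "\<And>t. t \<ge> r \<Longrightarrow> X \<subseteq> (*\<^sub>R) t ` U"
    using X(1) unfolding lcs_bounded_def by meson
  obtain N where N: "r < 2 ^ N" using real_arch_pow[of 2 r] by auto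
  show "\<forall>\<^sub>F n in sequentially. (1/2::real) ^ n *\<^sub>R y n \<in> U"
    using eventually_ge_at_top[of N]
  proof eventually_elim
    case (elim n)
    have "r \<le> 2 ^ n" using N power_increasing[of N n "2::real"] elim by linarith
    then obtain u where "u \<in> U" "y n = (2 ^ n) *\<^sub>R u" using r(2) X(2)[of n] by blast
    then show ?case by (simp add: power_mult_distrib[symmetric])
  qed
qed

context
  fixes X :: "'a::locally_convex_space set" and \<mu>
  assumes X: "compactly_convex X" and \<mu>: "\<mu> \<in> radon_prob X"
begin

interpretation prob_space \<mu> using \<mu> by (simp add: radon_prob_def)

lemma space_radon_prob: "space \<mu> = X"
  using \<mu> by (simp add: radon_prob_def)

lemma sets_radon_prob: "sets \<mu> = sets (restrict_space borel X)"
  using \<mu> by (simp add: radon_prob_def)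

lemma compact_in_sets_radon_prob: "compact C \<Longrightarrow> C \<subseteq> X \<Longrightarrow> C \<in> sets \<mu>"
  unfolding sets_radon_prob sets_restrict_space using borel_compact by fastforce

lemma borel_measurable_radon_prob:
  assumes "g \<in> borel_measurable borel" shows "g \<in> borel_measurable \<mu>"
  using measurable_restrict_space1[OF assms, of X] measurable_cong_sets[OF sets_radon_prob refl] by blast

lemma compact_exhausting:
  assumes "0 < e"
  obtains C where "compact C" "C \<subseteq> X" "1 - e < prob C"
proof -
  have "emeasure \<mu> X = (SUP K\<in>{K. compact K \<and> K \<subseteq> X}. emeasure \<mu> K)"
    using \<mu> sets.top[of \<mu>] by (simp add: radon_prob_def space_radon_prob)
  moreover have "ennreal (1 - e) < emeasure \<mu> X"
    using assms emeasure_space_1 by (simp add: space_radon_prob ennreal_less_one_iff)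
  ultimately obtain C where C: "compact C" "C \<subseteq> X" "ennreal (1 - e) < emeasure \<mu> C"
    by (auto simp: less_SUP_iff)
  then have "1 - e < prob C"
    by (cases "0 \<le> 1 - e") (auto simp: emeasure_eq_measure ennreal_less_iff intro: less_le_trans[OF _ measure_nonneg])
  then show thesis using that C by blast
qed

text \<open>Multiplying through by the mass of \<open>A\<close> covers pieces of measure zero as well.\<close>

lemma barycenter_of_piece:
  assumes A: "A \<in> sets \<mu>" "A \<subseteq> C" and C: "compact C" "C \<subseteq> X"
  obtains x where "x \<in> X" "\<And>f. f \<in> cdual \<Longrightarrow> prob A * f x = (\<integral>x. indicator A x * f x \<partial>\<mu>)"
proof (cases "prob A = 0")
  case True
  then have "AE x in \<mu>. x \<notin> A"
    using A(1) by (intro AE_not_in) (simp add: null_sets_def emeasure_eq_measure)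
  then have "AE x in \<mu>. indicator A x * f x = 0" for f :: "'a \<Rightarrow> real"
    by eventually_elim simp
  then have "(\<integral>x. indicator A x * f x \<partial>\<mu>) = 0" for f :: "'a \<Rightarrow> real"
    by (rule integral_eq_zero_AE)
  moreover obtain x where "x \<in> X" using not_empty space_radon_prob by auto
  ultimately show thesis using that True by auto
next
  case False
  then have pos: "0 < prob A" using measure_nonneg[of \<mu> A] by linarith
  define L where "L g = (\<integral>x. indicator A x * g x \<partial>\<mu>) / prob A" for g :: "'a \<Rightarrow> real"
  have int: "integrable \<mu> (\<lambda>x. indicator A x * g x)" if g: "g \<in> bdd_borel C" for g
  proof -
    obtain M where M: "\<And>x. x \<in> C \<Longrightarrow> \<bar>g x\<bar> \<le> M"
      using g unfolding bdd_borel_def bounded_iff by auto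
    have "norm (indicator A x * g x) \<le> \<bar>M\<bar>" for x
      using M[of x] A(2) by (auto simp: indicator_def)
    moreover have "g \<in> borel_measurable \<mu>"
      using g by (intro borel_measurable_radon_prob) (simp add: bdd_borel_def)
    then have "(\<lambda>x. indicator A x * g x) \<in> borel_measurable \<mu>"
      using A(1) by (intro borel_measurable_times borel_measurable_indicator)
    ultimately show ?thesis by (intro integrable_const_bound[of _ "\<bar>M\<bar>"]) auto
  qed
  have "mean C L"
    unfolding mean_def
  proof (intro conjI ballI allI impI)
    fix g h assume "g \<in> bdd_borel C" "h \<in> bdd_borel C"
    then show "L (\<lambda>x. g x + h x) = L g + L h"
      using int by (simp add: L_def distrib_left add_divide_distrib)
  next
    fix c g assume "g \<in> bdd_borel C"
    then show "L (\<lambda>x. c * g x) = c * L g" by (simp add: L_def mult.left_commute)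
  next
    fix c g assume g: "g \<in> bdd_borel C" "\<forall>x\<in>C. g x \<le> c"
    have "(\<integral>x. indicator A x * g x \<partial>\<mu>) \<le> (\<integral>x. indicator A x * c \<partial>\<mu>)"
    proof (rule integral_mono)
      show "indicator A x * g x \<le> indicator A x * c" for x
        using g(2) A(2) by (auto simp: indicator_def)
    qed (intro int g(1) bdd_borel_const)+
    also have "\<dots> = prob A * c" using A(1) by simp
    finally show "L g \<le> c" using pos by (simp add: L_def divide_le_eq mult.commute)
  qed
  then obtain x where x: "x \<in> top_of_set X closure_of (convex hull C)"
      "\<And>f. f \<in> cdual \<Longrightarrow> f x = L f"
  proof (rule mean_barycenter_in_compact)
    show "compact (top_of_set X closure_of (convex hull C))"
      using X C by (simp add: compactly_convex_def)
    show "convex hull C \<subseteq> top_of_set X closure_of (convex hull C)"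
      using X C(2) by (intro closure_of_subset) (simp add: hull_minimal compactly_convex_def)
  qed (use C in auto)
  have "x \<in> X" using x(1) closure_of_subset_topspace[of "top_of_set X"] by auto
  moreover have "prob A * f x = (\<integral>x. indicator A x * f x \<partial>\<mu>)" if "f \<in> cdual" for f
    using pos by (simp add: x(2)[OF that] L_def)
  ultimately show thesis by (rule that)
qed

text \<open>With compact \<open>C\<^sub>n\<close> of measure greater than \<open>1 - 4\<^sup>-\<^sup>(\<^sup>n\<^sup>+\<^sup>1\<^sup>)\<close>, the part of \<open>C\<^sub>n\<^sub>+\<^sub>1\<close> outside all earlier ones has
measure less than \<open>4\<^sup>-\<^sup>(\<^sup>n\<^sup>+\<^sup>1\<^sup>)\<close>.  The pieces are Borel sets rather than compact ones, which suffices since a mean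
on \<open>C\<^sub>n\<close> may be concentrated on any Borel subset.\<close>

lemma pieces:
  obtains A C :: "nat \<Rightarrow> 'a set"
  where "\<And>n. A n \<in> sets \<mu>" "\<And>n. A n \<subseteq> C n" "\<And>n. compact (C n)" "\<And>n. C n \<subseteq> X"
    "disjoint_family A" "AE x in \<mu>. x \<in> (\<Union>n. A n)" "\<And>n. prob (A (Suc n)) \<le> (1/4) ^ Suc n"
proof -
  have "\<exists>C. compact C \<and> C \<subseteq> X \<and> 1 - (1/4) ^ Suc n < prob C" for n :: nat
    by (rule compact_exhausting[of "(1/4) ^ Suc n"]) auto
  then obtain C where C: "\<And>n. compact (C n)" "\<And>n. C n \<subseteq> X" "\<And>n. 1 - (1/4) ^ Suc n < prob (C n)"
    by metis
  have Cs: "C n \<in> sets \<mu>" for n using C by (intro compact_in_sets_radon_prob)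
  define A where "A = disjointed C"
  have As: "A n \<in> sets \<mu>" for n
    unfolding A_def disjointed_def using Cs by auto
  show thesis
  proof
    show "A n \<subseteq> C n" for n unfolding A_def by (rule disjointed_subset)
    show "disjoint_family A" unfolding A_def by (rule disjoint_family_disjointed)
    show "prob (A (Suc n)) \<le> (1/4) ^ Suc n" for n
    proof -
      have "prob (A (Suc n)) \<le> prob (space \<mu> - C n)"
      proof (rule finite_measure_mono)
        show "A (Suc n) \<subseteq> space \<mu> - C n"
          using C(2)[of "Suc n"] by (auto simp: A_def disjointed_def space_radon_prob)
      qed (use Cs in auto)
      also have "\<dots> = 1 - prob (C n)" using Cs by (rule prob_compl)
      finally show ?thesis using C(3)[of n] by simp
    qed
    have "1 \<le> prob (\<Union>n. C n)"
    proof (rule field_le_epsilon)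
      fix e :: real assume "0 < e"
      then obtain n where "(1/4) ^ n < e" using real_arch_pow_inv[of e "1/4"] by auto
      moreover have "(1/4) ^ Suc n \<le> (1/4::real) ^ n" by simp
      moreover have "prob (C n) \<le> prob (\<Union>n. C n)" using Cs by (intro finite_measure_mono) auto
      ultimately show "1 \<le> prob (\<Union>n. C n) + e" using C(3)[of n] by linarith
    qed
    then have "prob (\<Union>n. C n) = 1" using prob_le_1 by (intro antisym)
    then have "AE x in \<mu>. x \<in> (\<Union>n. C n)" using Cs by (subst (asm) prob_eq_1) auto
    then show "AE x in \<mu>. x \<in> (\<Union>n. A n)" unfolding A_def UN_disjointed_eq .
  qed (use As C in auto)
qed

lemma integral_pieces:
  assumes A: "\<And>n::nat. A n \<in> sets \<mu>" "disjoint_family A" "AE x in \<mu>. x \<in> (\<Union>n. A n)"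
    and g: "g \<in> borel_measurable \<mu>" "\<And>x. x \<in> X \<Longrightarrow> \<bar>g x\<bar> \<le> (M::real)"
  shows "(\<lambda>N. \<Sum>n<N. \<integral>x. indicator (A n) x * g x \<partial>\<mu>) \<longlonglongrightarrow> (\<integral>x. g x \<partial>\<mu>)"
proof -
  have sums: "(\<lambda>n. indicator (A n) x) sums (indicator (\<Union>n. A n) x :: real)" for x
    using A(2) by (intro indicator_sums) (auto simp: disjoint_family_on_def)
  have int: "integrable \<mu> (\<lambda>x. indicator (A n) x * g x)" for n
  proof (rule integrable_const_bound[OF AE_I2])
    show "norm (indicator (A n) x * g x) \<le> \<bar>M\<bar>" if "x \<in> space \<mu>" for x
      using g(2)[of x] that by (auto simp: indicator_def space_radon_prob)
  qed (use A(1) g(1) in auto)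
  have "(\<lambda>N. \<integral>x. (\<Sum>n<N. indicator (A n) x) * g x \<partial>\<mu>) \<longlonglongrightarrow> (\<integral>x. g x \<partial>\<mu>)"
  proof (rule integral_dominated_convergence[where w = "\<lambda>_. M"])
    show "AE x in \<mu>. (\<lambda>N. (\<Sum>n<N. indicator (A n) x) * g x) \<longlonglongrightarrow> g x"
      using A(3)
    proof eventually_elim
      case (elim x)
      have "(\<lambda>N. (\<Sum>n<N. indicator (A n) x) * g x) \<longlonglongrightarrow> indicator (\<Union>n. A n) x * g x"
        using sums[of x] unfolding sums_def by (intro tendsto_mult tendsto_const)
      then show ?case using elim by simp
    qed
    show "AE x in \<mu>. norm ((\<Sum>n<N. indicator (A n) x) * g x) \<le> M" for N
    proof (rule AE_I2)
      fix x assume "x \<in> space \<mu>"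
      then have gx: "\<bar>g x\<bar> \<le> M" using g(2) by (simp add: space_radon_prob)
      have "(\<Sum>n<N. indicator (A n) x) \<le> (\<Sum>n. indicator (A n) x :: real)"
        using sums[of x] by (intro sum_le_suminf sums_summable) auto
      also have "\<dots> = indicator (\<Union>n. A n) x" by (rule sums_unique[OF sums, symmetric])
      also have "\<dots> \<le> 1" by (simp split: split_indicator)
      finally have "(\<Sum>n<N. indicator (A n) x) \<le> (1::real)" .
      then have "\<bar>\<Sum>n<N. indicator (A n) x\<bar> \<le> (1::real)" by (simp add: sum_nonneg)
      then show "norm ((\<Sum>n<N. indicator (A n) x) * g x) \<le> M"
        using gx mult_mono[of "\<bar>\<Sum>n<N. indicator (A n) x\<bar>" 1 "\<bar>g x\<bar>" M] by (simp add: abs_mult)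
    qed
  qed (use A(1) g(1) in auto)
  moreover have "(\<integral>x. (\<Sum>n<N. indicator (A n) x) * g x \<partial>\<mu>) = (\<Sum>n<N. \<integral>x. indicator (A n) x * g x \<partial>\<mu>)" for N
    unfolding sum_distrib_right using int by (rule Bochner_Integration.integral_sum)
  ultimately show ?thesis by simp
qed

text \<open>The partial sums \<open>s\<close> start from \<open>b 0\<close>, whose own term vanishes, so only the small masses \<open>p\<^sub>n\<close> with
\<open>n \<ge> 1\<close> are multiplied by \<open>2\<^sup>n\<close>.  Their convergence is not needed: a cluster point exists by compactness,
and continuous functionals converge along \<open>s\<close> to their integrals.\<close>

lemma radon_prob_has_barycenter:
  assumes bdd: "lcs_bounded X"
  obtains x where "x \<in> X" "\<And>f. f \<in> cdual \<Longrightarrow> f x = (\<integral>x. f x \<partial>\<mu>)"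
proof -
  have cvx: "convex X" using X by (simp add: compactly_convex_def)
  obtain A C where A: "\<And>n. A n \<in> sets \<mu>" "\<And>n. A n \<subseteq> C n" "\<And>n. compact (C n)" "\<And>n. C n \<subseteq> X"
    "disjoint_family A" "AE x in \<mu>. x \<in> (\<Union>n. A n)" "\<And>n. prob (A (Suc n)) \<le> (1/4) ^ Suc n"
    by (rule pieces) blast
  have "\<exists>x. x \<in> X \<and> (\<forall>f\<in>cdual. prob (A n) * f x = (\<integral>x. indicator (A n) x * f x \<partial>\<mu>))" for n
    using barycenter_of_piece[OF A(1,2,3,4), of n] by metis
  then obtain b where b: "\<And>n. b n \<in> X"
      "\<And>n f. f \<in> cdual \<Longrightarrow> prob (A n) * f (b n) = (\<integral>x. indicator (A n) x * f x \<partial>\<mu>)"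
    by metis
  define z where "z n = b 0 + (1/2) ^ n *\<^sub>R (b n - b 0)" for n
  have z: "z n \<in> X" for n
  proof -
    have "(1 - (1/2) ^ n) *\<^sub>R b 0 + (1/2) ^ n *\<^sub>R b n \<in> X"
      using b(1) by (intro convexD[OF cvx]) (auto simp: power_le_one)
    then show ?thesis by (simp add: z_def algebra_simps)
  qed
  have "z \<longlonglongrightarrow> b 0 + (0 - 0)"
    unfolding z_def scaleR_diff_right using b(1)
    by (intro tendsto_add tendsto_diff tendsto_const lcs_bounded_scaled_tendsto_0[OF bdd]) auto
  then have "compact (insert (b 0) (range z))"
    using compactin_sequence_with_limit[of euclidean z "b 0" "range z"] by simp
  define D where "D = top_of_set X closure_of (convex hull (insert (b 0) (range z)))"
  have Q: "insert (b 0) (range z) \<subseteq> X" using b z by auto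
  have D: "compact D" "D \<subseteq> X" "convex hull (insert (b 0) (range z)) \<subseteq> D"
    unfolding D_def
  proof -
    let ?Q = "insert (b 0) (range z)"
    show "compact (top_of_set X closure_of (convex hull ?Q))"
      using X \<open>compact ?Q\<close> Q by (simp add: compactly_convex_def)
    show "top_of_set X closure_of (convex hull ?Q) \<subseteq> X"
      using closure_of_subset_topspace[of "top_of_set X"] by auto
    show "convex hull ?Q \<subseteq> top_of_set X closure_of (convex hull ?Q)"
      using cvx Q by (intro closure_of_subset) (simp add: hull_minimal)
  qed
  define s where "s N = b 0 + (\<Sum>n<N. prob (A n) *\<^sub>R (b n - b 0))" for N
  have s: "s N \<in> D" for N
  proof -
    \<comment> \<open>The term for \<open>n = 0\<close> is zero, so its coefficient, which may be close to 1, is dropped.\<close>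
    define c where "c n = (if n = 0 then 0 else 2 ^ n * prob (A n))" for n
    have "c (Suc n) \<le> (1/2) ^ Suc n" for n
      using mult_left_mono[OF A(7)[of n], of "2 ^ Suc n"]
      by (simp add: c_def power_mult_distrib[symmetric] del: power_Suc)
    then have "(\<Sum>n<Suc N. c n) \<le> 1 - (1/2) ^ N" for N
    proof (induction N)
      case (Suc N)
      have "(\<Sum>n<Suc (Suc N). c n) \<le> (1 - (1/2) ^ N) + (1/2) ^ Suc N"
        using Suc.IH[OF Suc.prems] Suc.prems[of N] by simp
      then show ?case by simp
    qed (simp add: c_def)
    moreover have "(\<Sum>n<N. c n) \<le> (\<Sum>n<Suc N. c n)" by (simp add: c_def)
    ultimately have c1: "(\<Sum>n<N. c n) \<le> 1"
      by (smt (verit, best) zero_le_power divide_nonneg_nonneg)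
    have term_eq: "prob (A n) *\<^sub>R (b n - b 0) = c n *\<^sub>R (z n - b 0)" for n
      by (simp add: c_def z_def power_mult_distrib[symmetric])
    have "s N \<in> convex hull (insert (b 0) (range z))"
      unfolding s_def term_eq
      by (intro star_combination_in_convex c1) (auto simp: c_def intro: hull_inc)
    then show ?thesis using D(3) by blast
  qed
  have "filtermap s sequentially \<noteq> bot" by (simp add: filtermap_bot_iff)
  moreover have "\<forall>\<^sub>F x in filtermap s sequentially. x \<in> D" by (simp add: eventually_filtermap s)
  ultimately obtain x where x: "x \<in> D" "inf (nhds x) (filtermap s sequentially) \<noteq> bot"
    using D(1) unfolding compact_filter by blast
  have "f x = (\<integral>x. f x \<partial>\<mu>)" if f: "f \<in> cdual" for f
  proof -
    have lin: "linear f" and cont: "continuous_on UNIV f" using f by (auto simp: cdual_def)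
    have fm: "f \<in> borel_measurable \<mu>"
      using cont by (intro borel_measurable_radon_prob borel_measurable_continuous_onI)
    obtain M where M: "\<And>x. x \<in> X \<Longrightarrow> \<bar>f x\<bar> \<le> M"
      using weakly_bounded_if_lcs_bounded[OF bdd] f
      unfolding weakly_bounded_def bounded_iff by fastforce
    have "(\<lambda>N. \<Sum>n<N. \<integral>x. indicator (A n) x * (1::real) \<partial>\<mu>) \<longlonglongrightarrow> (\<integral>x. 1 \<partial>\<mu>)"
      by (rule integral_pieces[OF A(1,5,6), of "\<lambda>_. 1" 1]) auto
    then have one: "(\<lambda>N. \<Sum>n<N. prob (A n)) \<longlonglongrightarrow> 1" using A(1) prob_space by simp
    have "(\<lambda>N. \<Sum>n<N. prob (A n) * f (b n)) \<longlonglongrightarrow> (\<integral>x. f x \<partial>\<mu>)"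
      unfolding b(2)[OF f] by (intro integral_pieces[where M = M] A fm M)
    then have "(\<lambda>N. f (b 0) + ((\<Sum>n<N. prob (A n) * f (b n)) - (\<Sum>n<N. prob (A n)) * f (b 0)))
        \<longlonglongrightarrow> f (b 0) + ((\<integral>x. f x \<partial>\<mu>) - 1 * f (b 0))"
      by (intro tendsto_intros one)
    moreover have "f (s N) = f (b 0) + ((\<Sum>n<N. prob (A n) * f (b n)) - (\<Sum>n<N. prob (A n)) * f (b 0))" for N
      by (simp add: s_def linear_add[OF lin] linear_sum[OF lin] linear_scale[OF lin] linear_diff[OF lin]
          right_diff_distrib sum_subtractf sum_distrib_right)
    ultimately have "(\<lambda>N. f (s N)) \<longlonglongrightarrow> (\<integral>x. f x \<partial>\<mu>)" by simp
    then have "(f \<longlongrightarrow> (\<integral>x. f x \<partial>\<mu>)) (filtermap s sequentially)" by (simp add: filterlim_filtermap)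
    then have "(f \<longlongrightarrow> (\<integral>x. f x \<partial>\<mu>)) (inf (nhds x) (filtermap s sequentially))"
      by (rule tendsto_mono[rotated]) simp
    moreover have "(f \<longlongrightarrow> f x) (nhds x)"
      using cont by (simp add: continuous_on_def tendsto_at_iff_tendsto_nhds)
    then have "(f \<longlongrightarrow> f x) (inf (nhds x) (filtermap s sequentially))"
      by (rule tendsto_mono[rotated]) simp
    ultimately show ?thesis using tendsto_unique[OF x(2)] by blast
  qed
  then show thesis using that x(1) D(2) by blast
qed

end

theorem compactly_convex_imp_barycentric:
  fixes X :: "'a::locally_convex_space set"
  assumes bdd: "lcs_bounded X" and X: "compactly_convex X"
  shows "barycentric X"
  unfolding barycentric_def
proof (intro conjI bdd subsetI)
  show "convex X" using X by (simp add: compactly_convex_def)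
  fix F assume "F \<in> barycenter ` radon_prob X"
  then obtain \<mu> where \<mu>: "\<mu> \<in> radon_prob X" "F = barycenter \<mu>" by blast
  obtain x where "x \<in> X" "\<And>f. f \<in> cdual \<Longrightarrow> f x = (\<integral>x. f x \<partial>\<mu>)"
    using radon_prob_has_barycenter[OF X \<mu>(1) bdd] by blast
  then show "F \<in> bidual_embedding ` X"
    unfolding \<mu>(2) barycenter_def bidual_embedding_def
    by (intro image_eqI[of _ _ x]) (auto simp: restrict_def)
qed

section \<open>The equivalence\<close>

theorem theorem3p6:
  fixes X :: "'a::locally_convex_space set"
  assumes "lcs_bounded X" and "convex X"
  shows "barycentric X \<longleftrightarrow> compactly_convex X"
  using assms(1) barycentric_imp_compactly_convex compactly_convex_imp_barycentric by blast

end
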